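(* Let $\Phi:\mathbb{R}^n\to(-\infty,\infty]$ be a proper lower semicontinuous convex function. Then there exists a lower semicontinuous convex function $\varphi:[0,\infty)\times\mathbb{R}^n\to(-\infty,\infty]$, $\varphi=\varphi(x,y)$, such that (i) $\varphi(0,y)=\Phi(y)$ for all $y\in\mathbb{R}^n$; (ii) $\lim_{x\to0+}\varphi(x,y)=\Phi(y)$ for each $y\in\mathbb{R}^n$; (iii) $\varphi$ is real-valued and $C^\infty$ on $(0,\infty)\times\mathbb{R}^n$. Moreover: if $\Phi\ge 0$ then $\varphi$ can be chosen so that in addition $\varphi\ge0$; if $\Phi:\mathbb{R}^n\to(-\infty,\infty]$ is continuous (as a map into the extended reals), then $\varphi$ can be chosen so that in addition $\varphi:[0,\infty)\times\mathbb{R}^n\to(-\infty,\infty]$ is continuous; and if $\Phi$ is strictly convex on $\operatorname{dom}\Phi$, then $\varphi$ can be chosen so that in addition $\varphi$ is strictly convex on $(0,\infty)\times\mathbb{R}^n$.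
   Context: A convex function $\Phi:\mathbb{R}^n\to(-\infty,\infty]$ is proper if it is not identically $+\infty$. $\operatorname{dom}\Phi:=\{y\in\mathbb{R}^n:\Phi(y)<\infty\}$. Continuity into $(-\infty,\infty]$ is with respect to the usual topology of the extended real line. *)

theory Defs
  imports "HOL-Analysis.Analysis"
begin

definition proper_ext :: "('a \<Rightarrow> ereal) \<Rightarrow> bool" where
  "proper_ext f \<longleftrightarrow> (\<forall>y. f y \<noteq> -\<infinity>) \<and> (\<exists>y. f y \<noteq> \<infinity>)"

definition edom :: "('a \<Rightarrow> ereal) \<Rightarrow> 'a set" where
  "edom f = {y. f y < \<infinity>}"

text \<open>Convexity on S of a function with values in (-inf, inf] (ereal arithmetic, 0 * inf = 0).\<close>
definition ext_convex_on :: "'a::real_vector set \<Rightarrow> ('a \<Rightarrow> ereal) \<Rightarrow> bool" where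
  "ext_convex_on S f \<longleftrightarrow> convex S \<and>
     (\<forall>x\<in>S. \<forall>y\<in>S. \<forall>t::real. 0 \<le> t \<and> t \<le> 1 \<longrightarrow>
        f ((1 - t) *\<^sub>R x + t *\<^sub>R y) \<le> ereal (1 - t) * f x + ereal t * f y)"

definition ext_strict_convex_on :: "'a::real_vector set \<Rightarrow> ('a \<Rightarrow> ereal) \<Rightarrow> bool" where
  "ext_strict_convex_on S f \<longleftrightarrow> convex S \<and>
     (\<forall>x\<in>S. \<forall>y\<in>S. x \<noteq> y \<longrightarrow> (\<forall>t::real. 0 < t \<and> t < 1 \<longrightarrow>
        f ((1 - t) *\<^sub>R x + t *\<^sub>R y) < ereal (1 - t) * f x + ereal t * f y))"

definition lsc_on :: "'a::topological_space set \<Rightarrow> ('a \<Rightarrow> ereal) \<Rightarrow> bool" where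
  "lsc_on S f \<longleftrightarrow> (\<forall>x\<in>S. f x \<le> Liminf (at x within S) f)"

text \<open>C-infinity on an open set S: there are iterated Frechet derivatives of all orders,
  D k x [v1,...,vk] being the k-th derivative at x applied to the directions v1..vk.\<close>
definition smooth_on :: "'a::real_normed_vector set \<Rightarrow> ('a \<Rightarrow> real) \<Rightarrow> bool" where
  "smooth_on S f \<longleftrightarrow> open S \<and>
     (\<exists>D :: nat \<Rightarrow> 'a \<Rightarrow> 'a list \<Rightarrow> real.
        (\<forall>x\<in>S. D 0 x [] = f x) \<and>
        (\<forall>k x vs. x \<in> S \<and> length vs = k \<longrightarrow>
           ((\<lambda>y. D k y vs) has_derivative (\<lambda>v. D (Suc k) x (v # vs))) (at x)))"

end

theory Submission
  imports Defs
begin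

text \<open>
  Put \<open>E(x, y) = min\<^sub>w \<Phi>(w) + |y - w|\<^sup>2/x + x\<^sup>2\<close> for \<open>x > 0\<close> and \<open>E(0, y) = \<Phi>(y)\<close>. As
  \<open>|v|\<^sup>2/x\<close> is jointly convex, \<open>E\<close> is convex on the closed half-space; it is finite for \<open>x > 0\<close>
  because \<open>\<Phi>\<close> decreases at most linearly. The extension is the average
  \<open>\<phi>(p) = \<integral> E(p + x z) \<rho>(z) dz\<close>, where \<open>p = (x, y)\<close> and \<open>\<rho>\<close> is a bump function with small
  support. The maps \<open>p \<mapsto> p + x z\<close> are linear, so \<open>\<phi>\<close> is convex, and substituting \<open>q = p + x z\<close>
  moves the dependence on \<open>p\<close> into a smooth kernel. Bounding \<open>E(p + x z)\<close> by its competitor \<open>w = y\<close> gives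
  \<open>\<phi>(x, y) \<le> \<Phi>(y) + O(x)\<close>, and the lower semicontinuity of \<open>E\<close> at \<open>x = 0\<close> passes to \<open>\<phi>\<close>.
  If \<open>\<Phi>\<close> is strictly convex, the minimizers together with the term \<open>x\<^sup>2\<close> make \<open>E\<close>, and hence
  \<open>\<phi>\<close>, strictly convex.
\<close>

section \<open>Smoothness of kernel integrals\<close>

text \<open>A class closed under directional derivatives supplies its own higher derivatives:
  iterating \<open>step\<close> from \<open>f\<close> never leaves \<open>F\<close>.\<close>

lemma smooth_on_coinduct:
  assumes "open S" and "f \<in> F"
    and step: "\<And>f. f \<in> F \<Longrightarrow> \<exists>g. (\<forall>v. g v \<in> F) \<and> (\<forall>x\<in>S. (f has_derivative (\<lambda>v. g v x)) (at x))"
  shows "smooth_on S f"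
proof -
  obtain G where G: "\<And>f v. f \<in> F \<Longrightarrow> G f v \<in> F"
      "\<And>f x. f \<in> F \<Longrightarrow> x \<in> S \<Longrightarrow> (f has_derivative (\<lambda>v. G f v x)) (at x)"
    using step by metis
  \<comment> \<open>The newest direction is the head of the list, matching \<open>v # vs\<close> in
    \<open>smooth_on\<close>.\<close>
  define D where "D = rec_list f (\<lambda>v _ g. G g v)"
  have D_simps: "D [] = f" "\<And>v vs. D (v # vs) = G (D vs) v"
    by (simp_all add: D_def)
  have "D vs \<in> F" for vs
    by (induction vs) (simp_all add: D_simps assms(2) G(1))
  then show ?thesis
    unfolding smooth_on_def
    by (intro conjI exI[of _ "\<lambda>_ x vs. D vs x"]) (simp_all add: assms(1) D_simps G(2))
qed

lemma smooth_on_cong: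
  assumes "smooth_on S f" and "\<And>x. x \<in> S \<Longrightarrow> f x = g x"
  shows "smooth_on S g"
  using assms unfolding smooth_on_def by simp

section \<open>Flat exponential functions and the kernels built from them\<close>

definition flat :: "nat \<Rightarrow> real \<Rightarrow> real" where
  "flat m t = (if t \<le> 0 then 0 else exp (- (1 / t)) / t ^ m)"

lemma flat_nonneg: "0 \<le> flat m t"
  by (simp add: flat_def)

text \<open>On the right, \<open>s = inverse t\<close> turns this into the decay of
  \<open>s ^ m / exp s\<close> at infinity; on the left the function is 0.\<close>

lemma tendsto_flat_0: "(flat m \<longlongrightarrow> 0) (at 0)"
proof -
  have "((\<lambda>t. (inverse t) ^ m / exp (inverse t)) \<longlongrightarrow> 0) (at_right (0::real))"
    using filterlim_compose[OF tendsto_power_div_exp_0 filterlim_inverse_at_top_right] .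
  moreover have "eventually (\<lambda>t. (inverse t) ^ m / exp (inverse t) = flat m t) (at_right 0)"
    unfolding eventually_at_filter
    by (intro always_eventually) (auto simp: flat_def exp_minus field_simps)
  ultimately have r: "(flat m \<longlongrightarrow> 0) (at_right 0)"
    by (rule Lim_transform_eventually)
  have "eventually (\<lambda>t. 0 = flat m t) (at_left 0)"
    unfolding eventually_at_filter by (intro always_eventually) (auto simp: flat_def)
  then have "(flat m \<longlongrightarrow> 0) (at_left 0)"
    by (rule Lim_transform_eventually[OF tendsto_const])
  with r show ?thesis by (simp add: filterlim_split_at)
qed

text \<open>The index \<open>m\<close> makes the derivatives linear combinations of members of the
  same family, so that \<open>flat 0\<close> is smooth across 0.\<close>

lemma flat_has_derivative:
  "(flat m has_real_derivative (flat (m + 2) t - of_nat m * flat (m + 1) t)) (at t)"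
proof -
  consider "t < 0" | "t = 0" | "t > 0" by linarith
  then show ?thesis
  proof cases
    case 1
    have "((\<lambda>_. 0) has_real_derivative 0) (at t)" by simp
    then have "(flat m has_real_derivative 0) (at t)"
      by (rule has_field_derivative_transform_within_open[where S = "{..<0}"])
        (use 1 in \<open>auto simp: flat_def\<close>)
    with 1 show ?thesis by (simp add: flat_def)
  next
    case 2
    \<comment> \<open>The difference quotient at 0 is the same kind of function one index higher; at
      \<open>h = 0\<close> division by zero gives the right value 0.\<close>
    have "(\<lambda>h. (flat m (0 + h) - flat m 0) / h) = flat (Suc m)"
      by (auto simp: flat_def fun_eq_iff)
    then have "(flat m has_real_derivative 0) (at 0)"
      unfolding DERIV_def using tendsto_flat_0[of "Suc m"] by simp
    with 2 show ?thesis by (simp add: flat_def)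
  next
    case 3
    \<comment> \<open>The power rule produces \<open>t ^ (m - Suc 0)\<close>; for
      \<open>m = 0\<close> its factor vanishes.\<close>
    have pow: "m = 0 \<or> t ^ m = t * t ^ (m - Suc 0)"
      by (cases m) auto
    have "((\<lambda>t. exp (- (1 / t)) / t ^ m) has_real_derivative
       (flat (m + 2) t - of_nat m * flat (m + 1) t)) (at t)"
      using 3 pow
      by (auto intro!: derivative_eq_intros simp: flat_def field_simps power2_eq_square)
    then show ?thesis
      by (rule has_field_derivative_transform_within_open[where S = "{0<..}"])
        (use 3 in \<open>auto simp: flat_def\<close>)
  qed
qed

lemma continuous_on_flat: "continuous_on A (flat m)"
  by (meson DERIV_continuous continuous_at_imp_continuous_on flat_has_derivative)

text \<open>A class of functions of \<open>(p, q)\<close> that contains the mollification kernel and is closed under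
  directional derivatives in \<open>p\<close>, so that smoothness follows by coinduction.\<close>

inductive_set kernels :: "(real \<times> 'n::euclidean_space \<Rightarrow> real \<times> 'n \<Rightarrow> real) set" where
  const: "(\<lambda>p q. c) \<in> kernels"
| inner: "(\<lambda>p q. (q - p) \<bullet> b) \<in> kernels"
| sqnorm: "(\<lambda>p q. (q - p) \<bullet> (q - p)) \<in> kernels"
| inv: "(\<lambda>p q. inverse (fst p)) \<in> kernels"
| add: "k \<in> kernels \<Longrightarrow> l \<in> kernels \<Longrightarrow> (\<lambda>p q. k p q + l p q) \<in> kernels"
| mult: "k \<in> kernels \<Longrightarrow> l \<in> kernels \<Longrightarrow> (\<lambda>p q. k p q * l p q) \<in> kernels"
| flat: "k \<in> kernels \<Longrightarrow> (\<lambda>p q. flat m (k p q)) \<in> kernels"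

lemma kernels_power: "k \<in> kernels \<Longrightarrow> (\<lambda>p q. k p q ^ m) \<in> kernels"
  by (induction m) (auto intro: kernels.intros)

lemma continuous_on_kernel:
  assumes "k \<in> kernels"
  shows "continuous_on ({p. fst p > 0} \<times> UNIV) (\<lambda>(p, q). k p q)"
  using assms
proof induction
  case (flat k m)
  then show ?case
    using continuous_on_compose2[OF continuous_on_flat[of UNIV m] flat(2)]
    by (simp add: case_prod_unfold)
qed (auto simp: case_prod_unfold intro!: continuous_intros)

text \<open>Sum, product and chain rules express every derivative through the same generators; for
  \<open>flat\<close> this rests on its index shift, for \<open>inv\<close> on the derivative being
  minus the squared inverse times \<open>fst v\<close>.\<close>

lemma kernel_has_derivative:
  assumes "k \<in> kernels"
  shows "\<exists>k'. (\<forall>v. k' v \<in> kernels) \<and>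
    (\<forall>p q. fst p > 0 \<longrightarrow> ((\<lambda>p. k p q) has_derivative (\<lambda>v. k' v p q)) (at p))"
  using assms
proof induction
  case (const c)
  show ?case
    by (rule exI[of _ "\<lambda>v p q. 0"]) (auto intro: kernels.intros)
next
  case (inner b)
  show ?case
    by (rule exI[of _ "\<lambda>v p q. - (v \<bullet> b)"])
      (auto intro: kernels.intros intro!: derivative_eq_intros)
next
  case sqnorm
  have "(\<lambda>p q. - 2 * ((q - p) \<bullet> v)) \<in> kernels" for v :: "real \<times> 'a"
    by (intro kernels.intros)
  then show ?case
    by (intro exI[of _ "\<lambda>v p q. - 2 * ((q - p) \<bullet> v)"])
      (auto intro!: derivative_eq_intros simp: inner_commute algebra_simps)
next
  case inv
  have "(\<lambda>p q. (- fst v * inverse (fst p)) * inverse (fst p)) \<in> kernels" for v :: "real \<times> 'a"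
    by (intro kernels.intros)
  then show ?case
    by (intro exI[of _ "\<lambda>v p q. (- fst v * inverse (fst p)) * inverse (fst p)"])
      (auto intro!: derivative_eq_intros simp: field_simps)
next
  case (add k l)
  then obtain k' l' where "\<forall>v. k' v \<in> kernels" "\<forall>v. l' v \<in> kernels"
    "\<forall>p q. fst p > 0 \<longrightarrow> ((\<lambda>p. k p q) has_derivative (\<lambda>v. k' v p q)) (at p)"
    "\<forall>p q. fst p > 0 \<longrightarrow> ((\<lambda>p. l p q) has_derivative (\<lambda>v. l' v p q)) (at p)"
    by metis
  then show ?case
    by (intro exI[of _ "\<lambda>v p q. k' v p q + l' v p q"])
      (auto intro: kernels.intros intro!: has_derivative_add)
next
  case (mult k l)
  then obtain k' l' where "\<forall>v. k' v \<in> kernels" "\<forall>v. l' v \<in> kernels"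
    "\<forall>p q. fst p > 0 \<longrightarrow> ((\<lambda>p. k p q) has_derivative (\<lambda>v. k' v p q)) (at p)"
    "\<forall>p q. fst p > 0 \<longrightarrow> ((\<lambda>p. l p q) has_derivative (\<lambda>v. l' v p q)) (at p)"
    by metis
  with mult.hyps show ?case
    by (intro exI[of _ "\<lambda>v p q. k p q * l' v p q + k' v p q * l p q"] conjI allI impI
        has_derivative_mult kernels.add kernels.mult) auto
next
  case (flat k m)
  then obtain k' where k': "\<forall>v. k' v \<in> kernels"
    "\<forall>p q. fst p > 0 \<longrightarrow> ((\<lambda>p. k p q) has_derivative (\<lambda>v. k' v p q)) (at p)"
    by metis
  define l' where "l' v p q = (flat (m + 2) (k p q) + (- real m) * flat (m + 1) (k p q)) * k' v p q" for v p q
  have "(\<lambda>p q. (flat (m + 2) (k p q) + (- real m) * flat (m + 1) (k p q)) * k' v p q) \<in> kernels" for v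
    by (intro kernels.intros flat k'(1)[rule_format])
  then have "l' v \<in> kernels" for v by (simp add: l'_def[abs_def])
  moreover have "((\<lambda>p. flat m (k p q)) has_derivative
      (\<lambda>v. l' v p q)) (at p)"
    if "fst p > 0" for p q
    using has_derivative_compose[OF k'(2)[rule_format, OF that]
        flat_has_derivative[unfolded has_field_derivative_def]]
    by (simp add: l'_def)
  ultimately show ?case by (intro exI[of _ l']) simp
qed

text \<open>The radius \<open>fst p / 4\<close> keeps the support of \<open>k p\<close> inside the
  open half-space, where the functions to be mollified are continuous.\<close>

definition supported :: "(real \<times> 'n::euclidean_space \<Rightarrow> real \<times> 'n \<Rightarrow> real) \<Rightarrow> bool" where
  "supported k \<longleftrightarrow> (\<forall>p q. fst p > 0 \<longrightarrow> fst p / 4 < norm (q - p) \<longrightarrow> k p q = 0)"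

text \<open>The inequality is strict, so it persists for nearby \<open>p\<close>: there the kernel
  is constantly 0, hence so is its derivative.\<close>

lemma supported_derivative:
  assumes "supported k"
    and der: "\<And>p q. fst p > 0 \<Longrightarrow> ((\<lambda>p. k p q) has_derivative (\<lambda>v. k' v p q)) (at p)"
  shows "supported (k' v)"
  unfolding supported_def
proof (intro allI impI)
  fix p q :: "real \<times> 'a"
  assume p: "fst p > 0" and q: "fst p / 4 < norm (q - p)"
  have "open {p. fst p > 0 \<and> fst p / 4 < norm (q - p)}"
    by (intro open_Collect_conj open_Collect_less continuous_intros) auto
  then have "((\<lambda>p. 0) has_derivative (\<lambda>v. k' v p q)) (at p)"
    by (rule has_derivative_transform_within_open[OF der[OF p]])
      (use assms(1)[unfolded supported_def] p q in blast)+
  then have "(\<lambda>v. k' v p q) = (\<lambda>v. 0)"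
    by (rule has_derivative_unique) simp
  then show "k' v p q = 0" by metis
qed

section \<open>Cubes and differentiation under the integral sign\<close>

definition cube :: "'a::euclidean_space \<Rightarrow> real \<Rightarrow> 'a set" where
  "cube p r = cbox (p - r *\<^sub>R One) (p + r *\<^sub>R One)"

lemma mem_cube: "q \<in> cube p r \<longleftrightarrow> (\<forall>i\<in>Basis. \<bar>(q - p) \<bullet> i\<bar> \<le> r)"
proof -
  have "(p - r *\<^sub>R One) \<bullet> i \<le> q \<bullet> i \<and> q \<bullet> i \<le> (p + r *\<^sub>R One) \<bullet> i
      \<longleftrightarrow> \<bar>(q - p) \<bullet> i\<bar> \<le> r" if "i \<in> Basis" for i
    using that by (auto simp: abs_le_iff algebra_simps)
  then show ?thesis by (simp add: cube_def mem_box)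
qed

lemma norm_le_imp_mem_cube: "norm (q - p) \<le> r \<Longrightarrow> q \<in> cube p r"
  unfolding mem_cube by (meson Basis_le_norm order_trans)

lemma cube_fst:
  fixes p q :: "real \<times> 'n::euclidean_space"
  assumes "q \<in> cube p r"
  shows "\<bar>fst q - fst p\<bar> \<le> r"
proof -
  have "(1, 0) \<in> (Basis :: (real \<times> 'n) set)" by (simp add: Basis_prod_def)
  with assms have "\<bar>(q - p) \<bullet> (1, 0)\<bar> \<le> r" unfolding mem_cube by blast
  then show ?thesis by (simp add: inner_prod_def)
qed

lemma integral_eq_integral_UNIV:
  fixes f :: "'a::euclidean_space \<Rightarrow> 'b::banach"
  assumes "\<And>q. q \<notin> A \<Longrightarrow> f q = 0"
  shows "integral A f = integral UNIV f"
proof -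
  have "(\<lambda>x. if x \<in> A then f x else 0) = f" using assms by auto
  then show ?thesis using integral_restrict_UNIV[of A f] by simp
qed

text \<open>Locally in \<open>p\<close> all supports lie in one compact cube inside the half-space,
  so the Leibniz rule over that cube applies; only the kernel gets differentiated.\<close>

lemma kernel_integral_has_derivative:
  fixes \<psi> :: "real \<times> 'n::euclidean_space \<Rightarrow> real"
  assumes \<psi>: "continuous_on {p. fst p > 0} \<psi>"
    and k: "k \<in> kernels" "supported k"
    and k': "\<And>v. k' v \<in> kernels"
    and der: "\<And>p q. fst p > 0 \<Longrightarrow> ((\<lambda>p. k p q) has_derivative (\<lambda>v. k' v p q)) (at p)"
    and p0: "fst p0 > 0"
  shows "((\<lambda>p. integral UNIV (\<lambda>q. \<psi> q * k p q)) has_derivative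
     (\<lambda>v. integral UNIV (\<lambda>q. \<psi> q * k' v p0 q))) (at p0)"
proof -
  \<comment> \<open>Points of \<open>cube p0 r\<close> have first coordinate at least
    \<open>r\<close>. For \<open>p \<in> U\<close> the support radius is below
    \<open>3 * r / 4\<close> and \<open>p\<close> is within \<open>r / 4\<close> of
    \<open>p0\<close>, so the support fits into the cube.\<close>
  define r where "r = fst p0 / 2"
  define U where "U = ball p0 (r / 4)"
  have r: "r > 0" using p0 by (simp add: r_def)
  have U: "open U" "convex U" "p0 \<in> U" using r by (auto simp: U_def)
  have U_fst: "\<bar>fst p - fst p0\<bar> < r / 4" if "p \<in> U" for p
    using that dist_fst_le[of p0 p] by (simp add: U_def dist_real_def abs_minus_commute)
  have U_pos: "fst p > 0" if "p \<in> U" for p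
    using U_fst[OF that] p0 by (simp add: r_def abs_if split: if_splits)
  have cube_pos: "fst q > 0" if "q \<in> cube p0 r" for q
    using cube_fst[OF that] p0 by (simp add: r_def abs_if split: if_splits)
  have zero: "l p q = 0" if "supported l" "p \<in> U" "q \<notin> cube p0 r" for l p q
  proof -
    have "norm (q - p0) > r" using that(3) norm_le_imp_mem_cube[of q p0 r] by linarith
    moreover have "norm (q - p0) \<le> norm (q - p) + norm (p - p0)"
      using norm_triangle_ineq[of "q - p" "p - p0"] by simp
    moreover have "norm (p - p0) < r / 4"
      using that(2) by (simp add: U_def dist_norm norm_minus_commute)
    moreover have "fst p / 4 < 3 * r / 4" using U_fst[OF that(2)] r by (simp add: r_def abs_if split: if_splits)
    ultimately have "fst p / 4 < norm (q - p)" by linarith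
    then show ?thesis using that(1) U_pos[OF that(2)] unfolding supported_def by blast
  qed
  have to_cube: "integral (cube p0 r) (\<lambda>q. \<psi> q * l p q) = integral UNIV (\<lambda>q. \<psi> q * l p q)"
    if "supported l" "p \<in> U" for l p
    by (rule integral_eq_integral_UNIV) (simp add: zero[OF that])
  have cont: "continuous_on (U \<times> cube p0 r) (\<lambda>(p, q). \<psi> q * l p q)" if "l \<in> kernels" for l
  proof -
    have "continuous_on (U \<times> cube p0 r) (\<lambda>z. \<psi> (snd z))"
      by (rule continuous_on_compose2[OF \<psi>]) (use cube_pos in \<open>force intro!: continuous_intros\<close>)+
    moreover have "continuous_on (U \<times> cube p0 r) (\<lambda>(p, q). l p q)"
      by (rule continuous_on_subset[OF continuous_on_kernel[OF that]]) (use U_pos in blast)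
    ultimately show ?thesis by (auto simp: case_prod_unfold intro!: continuous_intros)
  qed
  have cont_at: "continuous_on (cube p0 r) (\<lambda>q. \<psi> q * l p q)" if "l \<in> kernels" "p \<in> U" for l p
  proof -
    have "continuous_on (cube p0 r) (Pair p)" by (intro continuous_intros)
    then have "continuous_on (cube p0 r) (\<lambda>q. case Pair p q of (p, q) \<Rightarrow> \<psi> q * l p q)"
      by (rule continuous_on_compose2[OF cont[OF that(1)]]) (use that(2) in blast)
    then show ?thesis by simp
  qed
  have lin: "bounded_linear (\<lambda>v. \<psi> q * k' v p q)" if "p \<in> U" for p q
    using has_derivative_bounded_linear[OF der[OF U_pos[OF that]], of q]
    by (rule bounded_linear_const_mult)
  \<comment> \<open>The Leibniz rule asks for a derivative that is continuous as a bounded linear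
    map; in finite dimension this can be checked direction by direction.\<close>
  define fx where "fx p q = Blinfun (\<lambda>v. \<psi> q * k' v p q)" for p q
  have fx: "blinfun_apply (fx p q) = (\<lambda>v. \<psi> q * k' v p q)" if "p \<in> U" for p q
    unfolding fx_def by (rule bounded_linear_Blinfun_apply[OF lin[OF that]])
  have fx_cont: "continuous_on (U \<times> cube p0 r) (\<lambda>(p, q). fx p q)"
  proof (rule continuous_on_blinfun_componentwise)
    fix i :: "real \<times> 'n"
    show "continuous_on (U \<times> cube p0 r) (\<lambda>x. blinfun_apply (case x of (p, q) \<Rightarrow> fx p q) i)"
      by (rule continuous_on_eq[OF cont[OF k'[of i]]]) (auto simp: fx)
  qed
  have fx_int: "fx p0 integrable_on cube p0 r"
  proof -
    have "continuous_on (cube p0 r) (Pair p0)" by (intro continuous_intros)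
    then have "continuous_on (cube p0 r) (\<lambda>q. case Pair p0 q of (p, q) \<Rightarrow> fx p q)"
      by (rule continuous_on_compose2[OF fx_cont]) (use U(3) in blast)
    then have "continuous_on (cube p0 r) (fx p0)" by simp
    then show ?thesis unfolding cube_def by (rule integrable_continuous)
  qed
  have "((\<lambda>p. integral (cube p0 r) (\<lambda>q. \<psi> q * k p q)) has_derivative
      blinfun_apply (integral (cube p0 r) (fx p0))) (at p0 within U)"
    unfolding cube_def
  proof (rule leibniz_rule)
    fix p q
    assume "p \<in> U"
    show "((\<lambda>p. \<psi> q * k p q) has_derivative blinfun_apply (fx p q)) (at p within U)"
      unfolding fx[OF \<open>p \<in> U\<close>]
      by (intro has_derivative_mult_right has_derivative_at_withinI[OF der] U_pos[OF \<open>p \<in> U\<close>])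
  next
    fix p
    assume "p \<in> U"
    show "(\<lambda>q. \<psi> q * k p q) integrable_on cbox (p0 - r *\<^sub>R One) (p0 + r *\<^sub>R One)"
      using cont_at[OF k(1) \<open>p \<in> U\<close>] unfolding cube_def by (rule integrable_continuous)
  qed (use fx_cont U in \<open>simp_all add: cube_def\<close>)
  moreover have "blinfun_apply (integral (cube p0 r) (fx p0)) =
      (\<lambda>v. integral UNIV (\<lambda>q. \<psi> q * k' v p0 q))"
  proof
    fix v
    have "blinfun_apply (integral (cube p0 r) (fx p0)) v = integral (cube p0 r) (\<lambda>q. fx p0 q v)"
      by (simp add: blinfun_apply_integral[OF fx_int])
    also have "\<dots> = integral (cube p0 r) (\<lambda>q. \<psi> q * k' v p0 q)"
      using U(3) by (simp add: fx)
    also have "\<dots> = integral UNIV (\<lambda>q. \<psi> q * k' v p0 q)"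
      by (rule to_cube[OF supported_derivative[OF k(2)] U(3)]) (rule der)
    finally show "blinfun_apply (integral (cube p0 r) (fx p0)) v =
      integral UNIV (\<lambda>q. \<psi> q * k' v p0 q)" .
  qed
  ultimately have "((\<lambda>p. integral (cube p0 r) (\<lambda>q. \<psi> q * k p q)) has_derivative
      (\<lambda>v. integral UNIV (\<lambda>q. \<psi> q * k' v p0 q))) (at p0)"
    by (simp add: at_within_open[OF U(3,1)])
  then show ?thesis
    by (rule has_derivative_transform_within_open[OF _ U(1,3)]) (rule to_cube[OF k(2)])
qed

text \<open>Coinduction over the integrals of one fixed \<open>\<psi>\<close> against all supported
  kernels: differentiation merely replaces the kernel by another one.\<close>

lemma smooth_on_kernel_integral:
  fixes \<psi> :: "real \<times> 'n::euclidean_space \<Rightarrow> real"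
  assumes \<psi>: "continuous_on {p. fst p > 0} \<psi>" and k: "k \<in> kernels" "supported k"
  shows "smooth_on {p. fst p > 0} (\<lambda>p. integral UNIV (\<lambda>q. \<psi> q * k p q))"
proof (rule smooth_on_coinduct
    [where F = "(\<lambda>k p. integral UNIV (\<lambda>q. \<psi> q * k p q)) ` {k \<in> kernels. supported k}"])
  show "open {p :: real \<times> 'n. fst p > 0}"
    by (intro open_Collect_less continuous_intros)
  show "(\<lambda>p. integral UNIV (\<lambda>q. \<psi> q * k p q))
      \<in> (\<lambda>k p. integral UNIV (\<lambda>q. \<psi> q * k p q)) ` {k \<in> kernels. supported k}"
    using k by blast
next
  fix f
  assume "f \<in> (\<lambda>k p. integral UNIV (\<lambda>q. \<psi> q * k p q)) ` {k \<in> kernels. supported k}"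
  then obtain l where l: "l \<in> kernels" "supported l" "f = (\<lambda>p. integral UNIV (\<lambda>q. \<psi> q * l p q))"
    by blast
  obtain l' where l': "\<And>v. l' v \<in> kernels"
    "\<And>p q. fst p > 0 \<Longrightarrow> ((\<lambda>p. l p q) has_derivative (\<lambda>v. l' v p q)) (at p)"
    using kernel_has_derivative[OF l(1)] by blast
  show "\<exists>g. (\<forall>v. g v \<in> (\<lambda>k p. integral UNIV (\<lambda>q. \<psi> q * k p q)) ` {k \<in> kernels. supported k}) \<and>
      (\<forall>x\<in>{p. fst p > 0}. (f has_derivative (\<lambda>v. g v x)) (at x))"
  proof (intro exI[of _ "\<lambda>v p. integral UNIV (\<lambda>q. \<psi> q * l' v p q)"] conjI allI ballI)
    fix v
    have supp: "supported (l' v)" by (rule supported_derivative[OF l(2)]) (rule l'(2))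
    show "(\<lambda>p. integral UNIV (\<lambda>q. \<psi> q * l' v p q))
        \<in> (\<lambda>k p. integral UNIV (\<lambda>q. \<psi> q * k p q)) ` {k \<in> kernels. supported k}"
      using l'(1) supp by blast
  next
    fix p :: "real \<times> 'n"
    assume "p \<in> {p. fst p > 0}"
    then have "fst p > 0" by (rule CollectD)
    show "(f has_derivative (\<lambda>v. integral UNIV (\<lambda>q. \<psi> q * l' v p q))) (at p)"
      unfolding l(3)
      by (rule kernel_integral_has_derivative[OF \<psi> l(1,2) l'(1) _ \<open>fst p > 0\<close>]) (rule l'(2))
  qed
qed

section \<open>Mollification with linearly varying width\<close>

text \<open>The numerator vanishes for \<open>norm z \<ge> 1 / 4\<close>, a bound that leaves room
  inside the cube; the quotient normalizes the mass to one.\<close>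

definition bump :: "real \<times> 'n::euclidean_space \<Rightarrow> real" where
  "bump z = flat 0 (1 / 16 - z \<bullet> z) / integral (cube 0 (1 / 2)) (\<lambda>z :: real \<times> 'n. flat 0 (1 / 16 - z \<bullet> z))"

text \<open>A continuous nonnegative function with integral 0 would vanish on the whole cube,
  including its centre.\<close>

lemma integral_cube_pos:
  fixes f :: "'a::euclidean_space \<Rightarrow> real"
  assumes "r > 0" and "continuous_on (cube p r) f" and "\<And>z. z \<in> cube p r \<Longrightarrow> 0 \<le> f z" and "f p > 0"
  shows "integral (cube p r) f > 0"
proof (rule ccontr)
  assume "\<not> ?thesis"
  have int: "f integrable_on cube p r"
    using assms(2) unfolding cube_def by (rule integrable_continuous)
  have "integral (cube p r) f \<ge> 0"
    by (rule integral_nonneg[OF int assms(3)])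
  with \<open>\<not> ?thesis\<close> have "(f has_integral 0) (cube p r)"
    using integrable_integral[OF int] by simp
  moreover have "p \<in> box (p - r *\<^sub>R One) (p + r *\<^sub>R One)"
    using assms(1) by (simp add: mem_box algebra_simps)
  moreover have "f z \<ge> 0" if "z \<in> box (p - r *\<^sub>R One) (p + r *\<^sub>R One)" for z
    using assms(3) that box_subset_cbox unfolding cube_def by blast
  ultimately have "f p = 0"
    using has_integral_0_cbox_imp_0[OF assms(2)[unfolded cube_def]] box_subset_cbox
    unfolding cube_def by blast
  with assms(4) show False by simp
qed

lemma bump_mass_pos:
  "integral (cube 0 (1 / 2)) (\<lambda>z :: real \<times> 'n::euclidean_space. flat 0 (1 / 16 - z \<bullet> z)) > 0"
proof (rule integral_cube_pos)
  show "continuous_on (cube 0 (1 / 2)) (\<lambda>z :: real \<times> 'n. flat 0 (1 / 16 - z \<bullet> z))"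
    by (rule continuous_on_compose2[OF continuous_on_flat[of UNIV]]) (auto intro!: continuous_intros)
qed (auto simp: flat_nonneg, simp add: flat_def)

lemma continuous_on_bump: "continuous_on A bump"
  unfolding bump_def using bump_mass_pos[where 'n = 'a]
  by (intro continuous_intros continuous_on_compose2[OF continuous_on_flat[of UNIV]]) auto

lemma bump_nonneg: "bump z \<ge> 0"
  unfolding bump_def using bump_mass_pos[where 'n = 'a] flat_nonneg by (simp add: less_imp_le)

lemma bump_0_pos: "bump 0 > 0"
  unfolding bump_def using bump_mass_pos[where 'n = 'a] by (simp add: flat_def)

lemma has_integral_bump: "(bump has_integral 1) (cube 0 (1 / 2))"
proof -
  have "integral (cube 0 (1 / 2)) (bump :: real \<times> 'a \<Rightarrow> real) = 1"
    unfolding bump_def using bump_mass_pos[where 'n = 'a] by simp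
  moreover have "(bump :: real \<times> 'a \<Rightarrow> real) integrable_on cube 0 (1 / 2)"
    unfolding cube_def by (rule integrable_continuous[OF continuous_on_bump])
  ultimately show ?thesis using integrable_integral by fastforce
qed

lemma bump_eq_0: "1 / 4 < norm z \<Longrightarrow> bump z = 0"
proof -
  assume "1 / 4 < norm z"
  then have "(1 / 4)\<^sup>2 < (norm z)\<^sup>2" by (intro power_strict_mono) auto
  then have "1 / 16 < z \<bullet> z" by (simp add: power2_norm_eq_inner power_divide)
  then show ?thesis by (simp add: bump_def flat_def)
qed

text \<open>Scaling the shift by \<open>fst p\<close> keeps the sample points in the half-space,
  leaves boundary values unchanged and makes each sample point linear in \<open>p\<close>.\<close>

definition mollify :: "(real \<times> 'n::euclidean_space \<Rightarrow> real) \<Rightarrow> real \<times> 'n \<Rightarrow> real" where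
  "mollify \<psi> p = integral (cube 0 (1 / 2)) (\<lambda>z. \<psi> (p + fst p *\<^sub>R z) * bump z)"

lemma fst_shift_bounds:
  assumes "z \<in> cube (0 :: real \<times> 'n::euclidean_space) (1 / 2)" and "fst p \<ge> 0"
  shows "fst p / 2 \<le> fst (p + fst p *\<^sub>R z)" and "fst (p + fst p *\<^sub>R z) \<le> 2 * fst p"
proof -
  have "\<bar>fst z\<bar> \<le> 1 / 2" using cube_fst[OF assms(1)] by simp
  then have "- (1 / 2) \<le> fst z" "fst z \<le> 1" by auto
  then have "fst p * (- (1 / 2)) \<le> fst p * fst z" "fst p * fst z \<le> fst p * 1"
    using assms(2) by (meson mult_left_mono)+
  then show "fst p / 2 \<le> fst (p + fst p *\<^sub>R z)" "fst (p + fst p *\<^sub>R z) \<le> 2 * fst p"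
    by auto
qed

lemma continuous_on_mollify_integrand:
  fixes \<psi> :: "real \<times> 'n::euclidean_space \<Rightarrow> real"
  assumes \<psi>: "continuous_on {p. fst p > 0} \<psi>" and "fst p \<ge> 0"
  shows "continuous_on (cube 0 (1 / 2)) (\<lambda>z. \<psi> (p + fst p *\<^sub>R z) * bump z)"
proof (cases "fst p = 0")
  \<comment> \<open>On the boundary every sample point is \<open>p\<close> itself, so the integrand
    is a constant multiple of \<open>bump\<close>.\<close>
  case True
  then show ?thesis by (auto intro!: continuous_intros continuous_on_bump)
next
  case False
  with assms(2) have "fst p > 0" by simp
  then have "continuous_on (cube 0 (1 / 2)) (\<lambda>z. \<psi> (p + fst p *\<^sub>R z))"
    using fst_shift_bounds(1)[of _ p]
    by (intro continuous_on_compose2[OF \<psi>] continuous_intros) force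
  then show ?thesis by (intro continuous_intros continuous_on_bump)
qed

lemma has_integral_mollify:
  fixes \<psi> :: "real \<times> 'n::euclidean_space \<Rightarrow> real"
  assumes "continuous_on {p. fst p > 0} \<psi>" and "fst p \<ge> 0"
  shows "((\<lambda>z. \<psi> (p + fst p *\<^sub>R z) * bump z) has_integral mollify \<psi> p) (cube 0 (1 / 2))"
proof -
  have "(\<lambda>z. \<psi> (p + fst p *\<^sub>R z) * bump z) integrable_on cube 0 (1 / 2)"
    using continuous_on_mollify_integrand[OF assms] unfolding cube_def by (rule integrable_continuous)
  then show ?thesis unfolding mollify_def by (rule integrable_integral)
qed

lemma mollify_boundary: "fst p = 0 \<Longrightarrow> mollify \<psi> p = \<psi> p"
  using has_integral_mult_right[OF has_integral_bump, of "\<psi> p"]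
  by (auto simp: mollify_def dest!: integral_unique)

text \<open>The weights \<open>bump z\<close> are nonnegative, have mass one and vanish for
  \<open>norm z > 1 / 4\<close>, so a bound on the remaining sample points passes to the
  average.\<close>

lemma mollify_ge:
  fixes \<psi> :: "real \<times> 'n::euclidean_space \<Rightarrow> real"
  assumes "continuous_on {p. fst p > 0} \<psi>" and "fst p \<ge> 0"
    and ge: "\<And>z. norm z \<le> 1 / 4 \<Longrightarrow> a \<le> \<psi> (p + fst p *\<^sub>R z)"
  shows "a \<le> mollify \<psi> p"
proof -
  have "((\<lambda>z. a * bump z) has_integral a) (cube (0 :: real \<times> 'n) (1 / 2))"
    using has_integral_mult_right[OF has_integral_bump, of a] by simp
  moreover have "a * bump z \<le> \<psi> (p + fst p *\<^sub>R z) * bump z" for z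
    using ge[of z] bump_eq_0[of z] bump_nonneg[of z]
    by (cases "norm z \<le> 1 / 4") (auto intro: mult_right_mono)
  ultimately show ?thesis
    using has_integral_le has_integral_mollify[OF assms(1,2)] by blast
qed

lemma mollify_le:
  fixes \<psi> :: "real \<times> 'n::euclidean_space \<Rightarrow> real"
  assumes "continuous_on {p. fst p > 0} \<psi>" and "fst p \<ge> 0"
    and le: "\<And>z. norm z \<le> 1 / 4 \<Longrightarrow> \<psi> (p + fst p *\<^sub>R z) \<le> a"
  shows "mollify \<psi> p \<le> a"
proof -
  have "((\<lambda>z. a * bump z) has_integral a) (cube (0 :: real \<times> 'n) (1 / 2))"
    using has_integral_mult_right[OF has_integral_bump, of a] by simp
  moreover have "\<psi> (p + fst p *\<^sub>R z) * bump z \<le> a * bump z" for z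
    using le[of z] bump_eq_0[of z] bump_nonneg[of z]
    by (cases "norm z \<le> 1 / 4") (auto intro: mult_right_mono)
  ultimately show ?thesis
    using has_integral_le has_integral_mollify[OF assms(1,2)] by blast
qed

text \<open>The substitution \<open>q = p + fst p *\<^sub>R z\<close>, with Jacobian
  \<open>fst p ^ N\<close>, moves the dependence on \<open>p\<close> from \<open>\<psi>\<close> into
  a supported kernel.\<close>

lemma smooth_on_mollify:
  fixes \<psi> :: "real \<times> 'n::euclidean_space \<Rightarrow> real"
  assumes \<psi>: "continuous_on {p. fst p > 0} \<psi>"
  shows "smooth_on {p. fst p > 0} (mollify \<psi>)"
proof -
  define N where "N = DIM(real \<times> 'n)"
  define c where "c = integral (cube 0 (1 / 2)) (\<lambda>z :: real \<times> 'n. flat 0 (1 / 16 - z \<bullet> z))"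
  \<comment> \<open>Spelled with the generators of \<open>kernels\<close> only, so that membership
    follows from its rules.\<close>
  define k :: "real \<times> 'n \<Rightarrow> real \<times> 'n \<Rightarrow> real" where
    "k p q = (inverse c * inverse (fst p) ^ N) *
       flat 0 (1 / 16 + (- 1) * (((q - p) \<bullet> (q - p)) * (inverse (fst p)) ^ 2))" for p q
  have k_kernel: "k \<in> kernels"
    unfolding k_def by (intro kernels.intros kernels_power)
  have k_bump: "k p q = inverse (fst p) ^ N * bump ((q - p) /\<^sub>R fst p)" for p q
  proof -
    have scale: "((q - p) /\<^sub>R fst p) \<bullet> ((q - p) /\<^sub>R fst p) = ((q - p) \<bullet> (q - p)) * (inverse (fst p)) ^ 2"
      by (simp add: power2_eq_square)
    have "inverse c * a * flat 0 (u + (- 1) * w) = a * (flat 0 (u - w) / c)" for a u w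
      by (simp add: divide_inverse)
    then show ?thesis
      unfolding k_def bump_def c_def[symmetric] scale by blast
  qed
  have k_supp: "supported k"
    unfolding supported_def
  proof (intro allI impI)
    fix p q :: "real \<times> 'n"
    assume *: "fst p > 0" "fst p / 4 < norm (q - p)"
    have "norm ((q - p) /\<^sub>R fst p) = norm (q - p) / fst p"
      using *(1) by (simp add: divide_inverse)
    also have "\<dots> > 1 / 4" using * by (simp add: pos_less_divide_eq)
    finally have "1 / 4 < norm ((q - p) /\<^sub>R fst p)" .
    then show "k p q = 0" unfolding k_bump by (simp only: bump_eq_0 mult_zero_right)
  qed
  have "integral UNIV (\<lambda>q. \<psi> q * k p q) = mollify \<psi> p" if "p \<in> {p. fst p > 0}" for p
  proof -
    have p: "fst p > 0" using that by simp
    \<comment> \<open>The unit-scale cube is displayed as the rescaled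
      \<open>cube p (fst p / 2)\<close>, the shape required by the affine change of
      variables.\<close>
    have box: "cube 0 (1 / 2) = cbox (((p - (fst p / 2) *\<^sub>R One) - p) /\<^sub>R fst p)
        (((p + (fst p / 2) *\<^sub>R One) - p) /\<^sub>R fst p)"
    proof -
      have "((p - (fst p / 2) *\<^sub>R One) - p) /\<^sub>R fst p = 0 - (1 / 2) *\<^sub>R One"
        "((p + (fst p / 2) *\<^sub>R One) - p) /\<^sub>R fst p = 0 + (1 / 2) *\<^sub>R One"
        using p by simp_all
      then show ?thesis unfolding cube_def by (simp only:)
    qed
    have k_shift: "k p (fst p *\<^sub>R z + p) = inverse (fst p ^ N) * bump z" for z
      using p by (simp add: k_bump power_inverse)
    have "((\<lambda>z. inverse (fst p ^ N) * (\<psi> (p + fst p *\<^sub>R z) * bump z)) has_integral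
        inverse (fst p ^ N) * mollify \<psi> p) (cube 0 (1 / 2))"
      by (intro has_integral_mult_right has_integral_mollify[OF \<psi>] less_imp_le[OF p])
    then have "((\<lambda>z. \<psi> (fst p *\<^sub>R z + p) * k p (fst p *\<^sub>R z + p)) has_integral
        mollify \<psi> p /\<^sub>R fst p ^ N) (cube 0 (1 / 2))"
      unfolding k_shift add.commute[of p] real_scaleR_def by (simp only: mult.left_commute)
    then have int: "((\<lambda>q. \<psi> q * k p q) has_integral mollify \<psi> p) (cube p (fst p / 2))"
      unfolding box N_def unfolding cube_def
      by (rule has_integral_affinity_iff[OF p, of "\<lambda>q. \<psi> q * k p q", THEN iffD1])
    have zero: "\<psi> q * k p q = 0" if "q \<notin> cube p (fst p / 2)" for q
    proof -
      have "norm (q - p) > fst p / 2" using that norm_le_imp_mem_cube[of q p "fst p / 2"] by linarith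
      then have "fst p / 4 < norm (q - p)" using p by linarith
      then have "k p q = 0" using k_supp p unfolding supported_def by blast
      then show ?thesis by simp
    qed
    have "integral UNIV (\<lambda>q. \<psi> q * k p q) = integral (cube p (fst p / 2)) (\<lambda>q. \<psi> q * k p q)"
      by (rule integral_eq_integral_UNIV[symmetric]) (rule zero)
    also have "\<dots> = mollify \<psi> p" using int by (rule integral_unique)
    finally show ?thesis .
  qed
  then show ?thesis
    by (rule smooth_on_cong[OF smooth_on_kernel_integral[OF \<psi> k_kernel k_supp]])
qed

text \<open>Sample points are linear in \<open>p\<close>, so the convexity inequality holds for each
  \<open>z\<close> and integrates against \<open>bump\<close>. They stay in \<open>E\<close>:
  boundary points are fixed, and all others remain in the open half-space.\<close>

lemma convex_mollify:
  fixes \<psi> :: "real \<times> 'n::euclidean_space \<Rightarrow> real"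
  assumes \<psi>: "continuous_on {p. fst p > 0} \<psi>" and conv: "convex_on E \<psi>"
    and E: "{p. fst p > 0} \<subseteq> E" "E \<subseteq> {p. fst p \<ge> 0}"
  shows "convex_on E (mollify \<psi>)"
proof (rule convex_onI)
  show "convex E" using conv by (rule convex_on_imp_convex)
  fix t :: real and p q
  assume t: "0 < t" "t < 1" and pq: "p \<in> E" "q \<in> E"
  define s where "s = (1 - t) *\<^sub>R p + t *\<^sub>R q"
  have s: "s \<in> E" unfolding s_def using \<open>convex E\<close> t pq by (simp add: convexD_alt)
  have nn: "fst p \<ge> 0" "fst q \<ge> 0" "fst s \<ge> 0" using pq s E by auto
  have shift: "r + fst r *\<^sub>R z \<in> E" if "r \<in> E" "z \<in> cube 0 (1 / 2)" for r z
  proof (cases "fst r = 0")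
    case False
    then have "fst r > 0" using that(1) E(2) by force
    then have "fst (r + fst r *\<^sub>R z) > 0" using fst_shift_bounds(1)[OF that(2), of r] by linarith
    then show ?thesis using E(1) by blast
  qed (use that in simp)
  have "\<psi> (s + fst s *\<^sub>R z) * bump z \<le>
      (1 - t) * (\<psi> (p + fst p *\<^sub>R z) * bump z) + t * (\<psi> (q + fst q *\<^sub>R z) * bump z)"
    if z: "z \<in> cube 0 (1 / 2)" for z
  proof -
    have "s + fst s *\<^sub>R z = (1 - t) *\<^sub>R (p + fst p *\<^sub>R z) + t *\<^sub>R (q + fst q *\<^sub>R z)"
      by (simp add: s_def algebra_simps)
    then have "\<psi> (s + fst s *\<^sub>R z) \<le> (1 - t) * \<psi> (p + fst p *\<^sub>R z) + t * \<psi> (q + fst q *\<^sub>R z)"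
      using convex_onD[OF conv, of t] t shift[OF pq(1) z] shift[OF pq(2) z] by simp
    from mult_right_mono[OF this bump_nonneg[of z]] show ?thesis by (simp add: algebra_simps)
  qed
  moreover have "((\<lambda>z. (1 - t) * (\<psi> (p + fst p *\<^sub>R z) * bump z) + t * (\<psi> (q + fst q *\<^sub>R z) * bump z))
      has_integral ((1 - t) * mollify \<psi> p + t * mollify \<psi> q)) (cube 0 (1 / 2))"
    by (intro has_integral_add has_integral_mult_right has_integral_mollify[OF \<psi>] nn)
  ultimately have "mollify \<psi> s \<le> (1 - t) * mollify \<psi> p + t * mollify \<psi> q"
    using has_integral_le[OF has_integral_mollify[OF \<psi> nn(3)]] by blast
  then show "mollify \<psi> ((1 - t) *\<^sub>R p + t *\<^sub>R q) \<le> (1 - t) * mollify \<psi> p + t * mollify \<psi> q"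
    by (simp add: s_def)
qed

text \<open>Strictness at the centre is enough: the gap in the convexity inequality is continuous
  and nonnegative in \<open>z\<close>, and positive at \<open>z = 0\<close>.\<close>

lemma mollify_strict_convex:
  fixes \<psi> :: "real \<times> 'n::euclidean_space \<Rightarrow> real"
  assumes conv: "convex_on {p. fst p > 0} \<psi>"
    and pq: "fst p > 0" "fst q > 0" and t: "0 < t" "t < 1"
    and strict: "\<psi> ((1 - t) *\<^sub>R p + t *\<^sub>R q) < (1 - t) * \<psi> p + t * \<psi> q"
  shows "mollify \<psi> ((1 - t) *\<^sub>R p + t *\<^sub>R q) < (1 - t) * mollify \<psi> p + t * mollify \<psi> q"
proof -
  have "open {p :: real \<times> 'n. fst p > 0}"
    by (intro open_Collect_less continuous_intros)
  then have \<psi>: "continuous_on {p. fst p > 0} \<psi>"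
    using conv by (rule convex_on_continuous)
  define s where "s = (1 - t) *\<^sub>R p + t *\<^sub>R q"
  have s: "fst s > 0" using t pq by (simp add: s_def add_pos_pos)
  have nn: "fst p \<ge> 0" "fst q \<ge> 0" "fst s \<ge> 0" using pq s by auto
  define g where "g z = (1 - t) * (\<psi> (p + fst p *\<^sub>R z) * bump z) + t * (\<psi> (q + fst q *\<^sub>R z) * bump z)
    - \<psi> (s + fst s *\<^sub>R z) * bump z" for z
  have "integral (cube 0 (1 / 2)) g > 0"
  proof (rule integral_cube_pos)
    show "continuous_on (cube 0 (1 / 2)) g"
      unfolding g_def by (intro continuous_intros continuous_on_mollify_integrand[OF \<psi>] nn)
    show "g z \<ge> 0" if z: "z \<in> cube 0 (1 / 2)" for z
    proof -
      have "s + fst s *\<^sub>R z = (1 - t) *\<^sub>R (p + fst p *\<^sub>R z) + t *\<^sub>R (q + fst q *\<^sub>R z)"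
        by (simp add: s_def algebra_simps)
      moreover have "fst (p + fst p *\<^sub>R z) > 0" "fst (q + fst q *\<^sub>R z) > 0"
        using fst_shift_bounds(1)[OF z nn(1)] fst_shift_bounds(1)[OF z nn(2)] pq by linarith+
      ultimately have "\<psi> (s + fst s *\<^sub>R z) \<le> (1 - t) * \<psi> (p + fst p *\<^sub>R z) + t * \<psi> (q + fst q *\<^sub>R z)"
        using convex_onD[OF conv, of t] t by simp
      from mult_right_mono[OF this bump_nonneg[of z]] show ?thesis by (simp add: g_def algebra_simps)
    qed
    have "g 0 = ((1 - t) * \<psi> p + t * \<psi> q - \<psi> s) * bump (0 :: real \<times> 'n)" by (simp add: g_def algebra_simps)
    then show "g 0 > 0" using strict bump_0_pos[where 'a = 'n] by (simp add: s_def)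
  qed simp
  moreover have "(g has_integral ((1 - t) * mollify \<psi> p + t * mollify \<psi> q - mollify \<psi> s)) (cube 0 (1 / 2))"
    unfolding g_def
    by (intro has_integral_diff has_integral_add has_integral_mult_right has_integral_mollify[OF \<psi>] nn)
  ultimately show ?thesis by (simp add: integral_unique s_def)
qed

section \<open>Lower semicontinuous functions\<close>

lemma lsc_onD:
  fixes f :: "'a::metric_space \<Rightarrow> ereal"
  assumes "lsc_on S f" and "x \<in> S" and "a < f x"
  obtains d where "d > 0" and "\<And>y. y \<in> S \<Longrightarrow> dist y x < d \<Longrightarrow> a < f y"
proof -
  have "eventually (\<lambda>y. a < f y) (at x within S)"
    using assms unfolding lsc_on_def le_Liminf_iff by blast
  then obtain d where "d > 0" "\<forall>y\<in>S. y \<noteq> x \<and> dist y x < d \<longrightarrow> a < f y"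
    unfolding eventually_at by blast
  with assms(3) that show thesis by metis
qed

lemma lsc_onI:
  fixes f :: "'a::metric_space \<Rightarrow> ereal"
  assumes "\<And>x a. x \<in> S \<Longrightarrow> ereal a < f x \<Longrightarrow> \<exists>d>0. \<forall>y\<in>S. dist y x < d \<longrightarrow> ereal a \<le> f y"
  shows "lsc_on S f"
  unfolding lsc_on_def le_Liminf_iff
proof (intro ballI allI impI)
  fix x a
  assume "x \<in> S" "a < f x"
  then obtain b where b: "a < ereal b" "ereal b < f x" using ereal_dense2 by blast
  then obtain d where "d > 0" "\<forall>y\<in>S. dist y x < d \<longrightarrow> ereal b \<le> f y"
    using assms \<open>x \<in> S\<close> by blast
  then show "eventually (\<lambda>y. a < f y) (at x within S)"
    unfolding eventually_at using b(1) less_le_trans by blast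
qed

lemma lsc_on_add_continuous:
  fixes f :: "'a::metric_space \<Rightarrow> ereal"
  assumes "lsc_on S f" and "continuous_on S g"
  shows "lsc_on S (\<lambda>x. f x + ereal (g x))"
proof (rule lsc_onI)
  fix x a
  assume x: "x \<in> S" and a: "ereal a < f x + ereal (g x)"
  then have "ereal (a - g x) < f x" by (cases "f x") auto
  \<comment> \<open>The slack \<open>b - (a - g x)\<close> is what \<open>g\<close> may lose near
    \<open>x\<close>.\<close>
  then obtain b where b: "ereal (a - g x) < ereal b" "ereal b < f x" using ereal_dense2 by blast
  obtain d where d: "d > 0" "\<And>y. y \<in> S \<Longrightarrow> dist y x < d \<Longrightarrow> ereal b < f y"
    using lsc_onD[OF assms(1) x b(2)] by blast
  have "b - (a - g x) > 0" using b(1) by simp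
  then obtain e where e: "e > 0"
      "\<And>y. y \<in> S \<Longrightarrow> dist y x < e \<Longrightarrow> dist (g y) (g x) < b - (a - g x)"
    using assms(2) x unfolding continuous_on_iff by metis
  have "ereal a \<le> f y + ereal (g y)" if "y \<in> S" "dist y x < min d e" for y
  proof -
    have "g y > a - b" using e(2)[of y] that by (auto simp: dist_real_def)
    then show ?thesis using d(2)[of y] that by (cases "f y") auto
  qed
  then show "\<exists>d>0. \<forall>y\<in>S. dist y x < d \<longrightarrow> ereal a \<le> f y + ereal (g y)"
    using d(1) e(1) by (intro exI[of _ "min d e"]) auto
qed

text \<open>Otherwise each \<open>x\<close> in \<open>K\<close> has a better point
  \<open>Y x\<close>, which by semicontinuity beats a whole ball around \<open>x\<close>. In a
  finite subcover, the best \<open>Y x0\<close> lies in some ball and is itself beaten.\<close>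

lemma lsc_on_attains_inf:
  fixes f :: "'a::metric_space \<Rightarrow> ereal"
  assumes "lsc_on UNIV f" and "compact K" and "K \<noteq> {}"
  obtains x where "x \<in> K" and "\<And>y. y \<in> K \<Longrightarrow> f x \<le> f y"
proof (rule ccontr)
  assume "\<not> thesis"
  then have "\<forall>x\<in>K. \<exists>y\<in>K. f y < f x" using that not_le by metis
  then have "\<forall>x\<in>K. \<exists>y d. y \<in> K \<and> d > 0 \<and> (\<forall>z. dist z x < d \<longrightarrow> f y < f z)"
    using lsc_onD[OF assms(1)] by (metis UNIV_I)
  then obtain Y d where Y: "\<And>x. x \<in> K \<Longrightarrow> Y x \<in> K" "\<And>x. x \<in> K \<Longrightarrow> d x > (0::real)"
      "\<And>x z. x \<in> K \<Longrightarrow> dist z x < d x \<Longrightarrow> f (Y x) < f z"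
    by metis
  have "K \<subseteq> (\<Union>x\<in>K. ball x (d x))" using Y(2) by force
  then obtain C where C: "C \<subseteq> K" "finite C" "K \<subseteq> (\<Union>x\<in>C. ball x (d x))"
    using compactE_image[OF assms(2), of K "\<lambda>x. ball x (d x)"] by blast
  have "C \<noteq> {}" using C(3) assms(3) by auto
  then obtain x0 where x0: "x0 \<in> C" "\<And>x. x \<in> C \<Longrightarrow> f (Y x0) \<le> f (Y x)"
    using arg_min_if_finite[OF C(2), of "\<lambda>x. f (Y x)"] not_le by metis
  then have "Y x0 \<in> K" using C(1) Y(1) by blast
  then obtain x1 where x1: "x1 \<in> C" "dist (Y x0) x1 < d x1"
    using C(3) by (auto simp: dist_commute)
  then have "f (Y x1) < f (Y x0)" using C(1) Y(3) by blast
  with x0(2)[OF x1(1)] show False by simp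
qed

section \<open>The regularized Moreau envelope\<close>

definition cost :: "real \<Rightarrow> 'n::real_inner \<Rightarrow> real" where
  "cost x v = (norm v)\<^sup>2 / x + x\<^sup>2"

lemma cost_0 [simp]: "cost 0 0 = 0"
  by (simp add: cost_def)

lemma cost_nonneg: "x \<ge> 0 \<Longrightarrow> cost x v \<ge> 0"
  by (simp add: cost_def)

text \<open>With \<open>v = x *\<^sub>R a\<close> and \<open>w = y *\<^sub>R b\<close>, possible at
  \<open>x = 0\<close> or \<open>y = 0\<close> by assumption, this is the expansion of a squared
  norm divided by the new parameter. The subtracted terms are the convexity defects of the two
  summands of \<open>cost\<close>.\<close>

lemma cost_combination:
  fixes v w :: "'n::real_inner"
  assumes x: "x \<ge> 0" "x = 0 \<longrightarrow> v = 0" and y: "y \<ge> 0" "y = 0 \<longrightarrow> w = 0" and t: "0 < t" "t < 1"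
  shows "cost ((1 - t) * x + t * y) ((1 - t) *\<^sub>R v + t *\<^sub>R w) =
    (1 - t) * cost x v + t * cost y w
    - (((1 - t) * x) * (t * y) * (norm (v /\<^sub>R x - w /\<^sub>R y))\<^sup>2 / ((1 - t) * x + t * y)
       + t * (1 - t) * (x - y)\<^sup>2)"
proof -
  define a b where "a = v /\<^sub>R x" and "b = w /\<^sub>R y"
  define \<alpha> \<beta> where "\<alpha> = (1 - t) * x" and "\<beta> = t * y"
  have v: "v = x *\<^sub>R a" and w: "w = y *\<^sub>R b" using x(2) y(2)
    by (cases "x = 0"; cases "y = 0"; simp add: a_def b_def)+
  have nn: "\<alpha> \<ge> 0" "\<beta> \<ge> 0" using x y t by (auto simp: \<alpha>_def \<beta>_def)
  have comb: "(1 - t) *\<^sub>R v + t *\<^sub>R w = \<alpha> *\<^sub>R a + \<beta> *\<^sub>R b" by (simp add: v w \<alpha>_def \<beta>_def)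
  have "(norm (\<alpha> *\<^sub>R a + \<beta> *\<^sub>R b))\<^sup>2 =
      (\<alpha> + \<beta>) * (\<alpha> * (norm a)\<^sup>2 + \<beta> * (norm b)\<^sup>2) - \<alpha> * \<beta> * (norm (a - b))\<^sup>2"
    by (simp add: power2_norm_eq_inner inner_simps inner_commute algebra_simps)
  \<comment> \<open>If \<open>\<alpha> + \<beta> = 0\<close>, division by zero turns both sides of
    the next identity into 0.\<close>
  moreover have "\<alpha> = 0" "\<beta> = 0" if "\<alpha> + \<beta> = 0" using that nn by auto
  ultimately have sq: "(norm ((1 - t) *\<^sub>R v + t *\<^sub>R w))\<^sup>2 / (\<alpha> + \<beta>) =
      \<alpha> * (norm a)\<^sup>2 + \<beta> * (norm b)\<^sup>2 - \<alpha> * \<beta> * (norm (a - b))\<^sup>2 / (\<alpha> + \<beta>)"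
    unfolding comb by (cases "\<alpha> + \<beta> = 0") (auto simp: diff_divide_distrib)
  have na: "(norm v)\<^sup>2 / x = x * (norm a)\<^sup>2" "(norm w)\<^sup>2 / y = y * (norm b)\<^sup>2"
    unfolding v w by (simp_all add: power_mult_distrib) (simp_all add: power2_eq_square)
  have "((1 - t) * x + t * y)\<^sup>2 = (1 - t) * x\<^sup>2 + t * y\<^sup>2 - t * (1 - t) * (x - y)\<^sup>2"
    by algebra
  then show ?thesis
    using sq unfolding cost_def na
    by (simp add: \<alpha>_def \<beta>_def flip: a_def b_def) (simp add: algebra_simps)
qed

lemma cost_convex:
  fixes v w :: "'n::real_inner"
  assumes "x \<ge> 0" "x = 0 \<longrightarrow> v = 0" "y \<ge> 0" "y = 0 \<longrightarrow> w = 0" "0 < t" "t < 1"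
  shows "cost ((1 - t) * x + t * y) ((1 - t) *\<^sub>R v + t *\<^sub>R w) \<le> (1 - t) * cost x v + t * cost y w"
proof -
  have "((1 - t) * x) * (t * y) * (norm (v /\<^sub>R x - w /\<^sub>R y))\<^sup>2 / ((1 - t) * x + t * y)
       + t * (1 - t) * (x - y)\<^sup>2 \<ge> 0"
    using assms by simp
  then show ?thesis using cost_combination[OF assms] by linarith
qed

text \<open>For \<open>x \<noteq> y\<close> the defect of the square is positive; for
  \<open>x = y\<close> the slopes \<open>v /\<^sub>R x\<close> and \<open>w /\<^sub>R y\<close>
  differ, so the other defect is.\<close>

lemma cost_strict_convex:
  fixes v w :: "'n::real_inner"
  assumes x: "x > 0" and y: "y > 0" and t: "0 < t" "t < 1" and neq: "(x, v) \<noteq> (y, w)"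
  shows "cost ((1 - t) * x + t * y) ((1 - t) *\<^sub>R v + t *\<^sub>R w) < (1 - t) * cost x v + t * cost y w"
proof -
  have "((1 - t) * x) * (t * y) * (norm (v /\<^sub>R x - w /\<^sub>R y))\<^sup>2 / ((1 - t) * x + t * y)
       + t * (1 - t) * (x - y)\<^sup>2 > 0"
  proof (cases "x = y")
    case True
    with neq x have "v /\<^sub>R x - w /\<^sub>R y \<noteq> 0" by auto
    then show ?thesis using x y t by (intro add_pos_nonneg divide_pos_pos mult_pos_pos add_pos_pos) auto
  next
    case False
    then show ?thesis using x y t by (intro add_nonneg_pos) auto
  qed
  then show ?thesis using cost_combination[of x v y w t] x y t by simp
qed

text \<open>For \<open>fst p > 0\<close> this is the Moreau envelope of \<open>\<Phi>\<close> with parameter \<open>fst p / 2\<close>. Since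
  \<open>(x, v) \<mapsto> (norm v)\<^sup>2 / x\<close> is jointly convex, so is the envelope; the summand \<open>x\<^sup>2\<close> in the
  cost breaks the linearity along the rays on which that function is affine. At \<open>fst p = 0\<close> only
  \<open>cost 0 0 = 0\<close> is meaningful, and it holds since \<open>0 / 0 = 0\<close>.\<close>

definition env :: "('n::real_inner \<Rightarrow> ereal) \<Rightarrow> real \<times> 'n \<Rightarrow> ereal" where
  "env \<Phi> p = (if fst p = 0 then \<Phi> (snd p)
     else (INF z. \<Phi> z + ereal (cost (fst p) (snd p - z))))"

lemma env_boundary [simp]: "env \<Phi> (0, y) = \<Phi> y"
  by (simp add: env_def)

text \<open>On the boundary \<open>snd p\<close> is the only competitor, at cost 0; this lets
  boundary and interior be treated alike.\<close>

lemma env_le: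
  assumes "fst p = 0 \<Longrightarrow> z = snd p"
  shows "env \<Phi> p \<le> \<Phi> z + ereal (cost (fst p) (snd p - z))"
  using assms by (auto simp: env_def intro: INF_lower)

lemma convex_nonneg_fst: "convex {p :: real \<times> 'n::real_vector. fst p \<ge> 0}"
  by (auto simp: convex_alt)

lemma convex_pos_fst: "convex {p :: real \<times> 'n::real_vector. fst p > 0}"
  unfolding convex_alt by (auto simp: add_nonneg_pos add_pos_nonneg less_eq_real_def)

section \<open>Linear lower bound and attainment of the infimum\<close>

locale closed_convex =
  fixes \<Phi> :: "'n::euclidean_space \<Rightarrow> ereal"
  assumes proper: "proper_ext \<Phi>" and lsc: "lsc_on UNIV \<Phi>" and conv: "ext_convex_on UNIV \<Phi>"
begin

lemma not_MInf [simp]: "\<Phi> y \<noteq> -\<infinity>"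
  using proper by (simp add: proper_ext_def)

lemma finite_point:
  obtains y c where "\<Phi> y = ereal c"
  using proper not_MInf unfolding proper_ext_def by (metis ereal_cases)

lemma convex_combination_le:
  assumes "\<Phi> y = ereal b" and "\<Phi> z = ereal c" and "0 \<le> t" and "t \<le> 1"
  shows "\<Phi> ((1 - t) *\<^sub>R y + t *\<^sub>R z) \<le> ereal ((1 - t) * b + t * c)"
  using conv assms unfolding ext_convex_on_def
  by (metis UNIV_I plus_ereal.simps(1) times_ereal.simps(1))

text \<open>Compactness bounds \<open>\<Phi>\<close> below on a unit ball around a point
  \<open>y0\<close> of finite value. Farther out, a steeper than linear decrease would by convexity
  violate this bound on the unit sphere.\<close>

lemma linear_lower_bound:
  obtains C where "C \<ge> 0" and "\<And>z. \<Phi> z \<ge> ereal (- (C * (1 + norm z)))"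
proof -
  obtain y0 c where y0: "\<Phi> y0 = ereal c" by (rule finite_point)
  obtain m where m: "m \<in> cball y0 1" "\<And>y. y \<in> cball y0 1 \<Longrightarrow> \<Phi> m \<le> \<Phi> y"
    by (rule lsc_on_attains_inf[OF lsc compact_cball[of y0 1]]) auto
  have "\<Phi> m \<le> ereal c" using m(2)[of y0] y0 by simp
  then obtain L where L: "\<Phi> m = ereal L" using not_MInf[of m] by (cases "\<Phi> m") auto
  define C where "C = \<bar>L\<bar> + \<bar>c\<bar>"
  have C: "C \<ge> 0" by (simp add: C_def)
  have bound: "\<Phi> z \<ge> ereal (- (C * (1 + norm (z - y0))))" for z
  proof (cases "norm (z - y0) \<le> 1")
    case True
    then have "ereal L \<le> \<Phi> z" using m(2)[of z] L by (simp add: dist_norm norm_minus_commute)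
    moreover have "- (C * (1 + norm (z - y0))) \<le> L"
    proof -
      have "C * 1 \<le> C * (1 + norm (z - y0))" using C by (intro mult_left_mono) auto
      then show ?thesis by (simp add: C_def)
    qed
    ultimately show ?thesis by (meson ereal_less_eq(3) order_trans)
  next
    case False
    define r where "r = norm (z - y0)"
    have r: "r > 1" using False by (simp add: r_def)
    show ?thesis
    proof (cases "\<Phi> z")
      case (real b)
      \<comment> \<open>The point at distance 1 from \<open>y0\<close> on the segment towards
        \<open>z\<close>.\<close>
      define w where "w = (1 - 1 / r) *\<^sub>R y0 + (1 / r) *\<^sub>R z"
      have "y0 - w = - ((1 / r) *\<^sub>R (z - y0))" by (simp add: w_def algebra_simps)
      then have "norm (y0 - w) = 1" using r by (auto simp: r_def)
      then have "ereal L \<le> \<Phi> w" using m(2)[of w] L by (simp add: dist_norm)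
      also have "\<dots> \<le> ereal ((1 - 1 / r) * c + (1 / r) * b)"
        unfolding w_def by (rule convex_combination_le[OF y0 real]) (use r in auto)
      finally have "L \<le> (1 - 1 / r) * c + (1 / r) * b" by simp
      then have "r * L \<le> r * ((1 - 1 / r) * c + (1 / r) * b)"
        using r by (intro mult_left_mono) auto
      also have "\<dots> = (r - 1) * c + b" using r by (simp add: field_simps)
      finally have "r * L - (r - 1) * c \<le> b" by simp
      moreover have "r * L \<ge> - (r * \<bar>L\<bar>)" using r
        by (metis abs_ge_minus_self abs_mult abs_of_pos less_trans minus_le_iff zero_less_one)
      moreover have "(r - 1) * c \<le> r * \<bar>c\<bar>"
        using r mult_left_mono[of c "\<bar>c\<bar>" "r - 1"] mult_right_mono[of "r - 1" r "\<bar>c\<bar>"] by linarith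
      ultimately have "- (r * \<bar>L\<bar>) - r * \<bar>c\<bar> \<le> b" by linarith
      moreover have "r * \<bar>L\<bar> + r * \<bar>c\<bar> = C * r" by (simp add: C_def algebra_simps)
      moreover have "C * r \<le> C * (1 + r)" using C by (intro mult_left_mono) auto
      ultimately have "- (C * (1 + r)) \<le> b" by linarith
      then show ?thesis using real by (simp add: r_def)
    qed auto
  qed
  \<comment> \<open>Recentres the bound from \<open>y0\<close> to the origin.\<close>
  define C' where "C' = C * (1 + norm y0)"
  have "\<Phi> z \<ge> ereal (- (C' * (1 + norm z)))" for z
  proof -
    have "norm (z - y0) \<le> norm z + norm y0" by (rule norm_triangle_ineq4)
    moreover have "0 \<le> norm y0 * norm z" by simp
    ultimately have "1 + norm (z - y0) \<le> (1 + norm y0) * (1 + norm z)"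
      unfolding distrib_left distrib_right by linarith
    then have "C * (1 + norm (z - y0)) \<le> C' * (1 + norm z)"
      unfolding C'_def mult.assoc using C by (rule mult_left_mono)
    then show ?thesis by (intro order_trans[OF _ bound[of z]]) simp
  qed
  moreover have "C' \<ge> 0" using C by (simp add: C'_def)
  ultimately show thesis using that by blast
qed

text \<open>The quadratic part of the cost competes with the linear lower bound. One
  \<open>C\<close> serves all \<open>x\<close>, which gives both coercivity for fixed
  \<open>x\<close> and control as \<open>x\<close> tends to 0.\<close>

lemma growth:
  obtains C where "C \<ge> 0"
    and "\<And>x y z. x \<ge> 0 \<Longrightarrow> ereal ((norm (y - z))\<^sup>2 / x - C * (1 + norm y + norm (y - z)))
      \<le> \<Phi> z + ereal (cost x (y - z))"
proof -
  obtain C where C: "C \<ge> 0" "\<And>z. \<Phi> z \<ge> ereal (- (C * (1 + norm z)))"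
    by (rule linear_lower_bound) blast
  have "ereal ((norm (y - z))\<^sup>2 / x - C * (1 + norm y + norm (y - z))) \<le> \<Phi> z + ereal (cost x (y - z))"
    for x y z
  proof -
    have "norm z \<le> norm y + norm (y - z)" using norm_triangle_ineq4[of y "y - z"] by simp
    then have "C * (1 + norm z) \<le> C * (1 + norm y + norm (y - z))"
      using C(1) by (intro mult_left_mono) auto
    then have "ereal (- (C * (1 + norm y + norm (y - z)))) \<le> \<Phi> z"
      by (intro order_trans[OF _ C(2)[of z]]) simp
    moreover have "ereal ((norm (y - z))\<^sup>2 / x) \<le> ereal (cost x (y - z))" by (simp add: cost_def)
    ultimately have "ereal (- (C * (1 + norm y + norm (y - z)))) + ereal ((norm (y - z))\<^sup>2 / x)
        \<le> \<Phi> z + ereal (cost x (y - z))" by (rule add_mono)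
    then show ?thesis by simp
  qed
  with C(1) that show thesis by blast
qed

text \<open>The objective attains its minimum over a large ball; outside, \<open>growth\<close>
  keeps it above its value \<open>v0\<close> at a point of the ball.\<close>

lemma inf_attained:
  assumes x: "x > 0"
  obtains z b where "\<Phi> z = ereal b"
    and "\<And>w. ereal (b + cost x (y - z)) \<le> \<Phi> w + ereal (cost x (y - w))"
proof -
  define f where "f = (\<lambda>z. \<Phi> z + ereal (cost x (y - z)))"
  obtain y0 c where y0: "\<Phi> y0 = ereal c" by (rule finite_point)
  obtain C where C: "C \<ge> 0"
      "\<And>x y z. x \<ge> 0 \<Longrightarrow> ereal ((norm (y - z))\<^sup>2 / x - C * (1 + norm y + norm (y - z))) \<le> \<Phi> z + ereal (cost x (y - z))"
    by (rule growth) blast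
  define v0 where "v0 = c + cost x (y - y0)"
  define u where "u = v0 + C * (1 + norm y)"
  \<comment> \<open>Chosen so that \<open>r \<ge> R\<close> gives
    \<open>r / x - C \<ge> \<bar>u\<bar> + 1\<close> and \<open>r \<ge> 1\<close>, hence
    \<open>r * (r / x - C) \<ge> u\<close>; the last summand puts \<open>y0\<close> into the
    ball.\<close>
  define R where "R = 1 + x * (C + \<bar>u\<bar> + 1) + norm (y - y0)"
  have "x * (C + \<bar>u\<bar> + 1) > 0" using x C(1) by (intro mult_pos_pos) auto
  then have R: "R \<ge> 1" "R \<ge> x * (C + \<bar>u\<bar> + 1)" "R \<ge> norm (y - y0)"
    using norm_ge_zero[of "y - y0"] unfolding R_def by linarith+
  have far: "ereal v0 \<le> f z" if "norm (y - z) \<ge> R" for z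
  proof -
    define r where "r = norm (y - z)"
    have r: "r \<ge> 1" "r \<ge> x * (C + \<bar>u\<bar> + 1)" using that R by (auto simp: r_def)
    then have "r / x - C \<ge> \<bar>u\<bar> + 1" using x by (simp add: field_simps)
    then have "1 * (\<bar>u\<bar> + 1) \<le> r * (r / x - C)" using r(1) by (intro mult_mono) auto
    then have "r\<^sup>2 / x - C * (1 + norm y + r) \<ge> v0"
      by (simp add: u_def power2_eq_square algebra_simps)
    then have "ereal v0 \<le> ereal ((norm (y - z))\<^sup>2 / x - C * (1 + norm y + norm (y - z)))"
      by (simp add: r_def)
    also have "\<dots> \<le> f z" unfolding f_def using x by (intro C(2)) simp
    finally show ?thesis .
  qed
  have "lsc_on UNIV f"
    unfolding f_def cost_def
    by (intro lsc_on_add_continuous lsc continuous_intros) (use x in auto)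
  then obtain m where m: "m \<in> cball y R" "\<And>z. z \<in> cball y R \<Longrightarrow> f m \<le> f z"
    by (rule lsc_on_attains_inf[OF _ compact_cball[of y R]]) (use R(1) in auto)
  have fm: "f m \<le> ereal v0"
    using m(2)[of y0] R(3) y0 by (simp add: f_def v0_def dist_norm)
  then obtain b where b: "\<Phi> m = ereal b"
    using not_MInf[of m] unfolding f_def by (cases "\<Phi> m") auto
  have "f m \<le> f w" for w
  proof (cases "norm (y - w) \<le> R")
    case True
    then show ?thesis using m(2)[of w] by (simp add: dist_norm)
  next
    case False
    then show ?thesis using far[of w] fm by (meson le_cases order_trans)
  qed
  then show thesis using that[of m b] b by (simp add: f_def)
qed

lemma env_attained:
  assumes "fst p \<ge> 0" and "env \<Phi> p < \<infinity>"
  obtains z b where "\<Phi> z = ereal b" and "fst p = 0 \<Longrightarrow> z = snd p"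
    and "env \<Phi> p = ereal (b + cost (fst p) (snd p - z))"
proof (cases "fst p = 0")
  case True
  then obtain b where "\<Phi> (snd p) = ereal b"
    using assms(2) not_MInf[of "snd p"] by (cases "\<Phi> (snd p)") (auto simp: env_def)
  with True that[of "snd p" b] show thesis by (simp add: env_def)
next
  case False
  with assms(1) have x: "fst p > 0" by simp
  obtain z b where z: "\<Phi> z = ereal b"
      "\<And>w. ereal (b + cost (fst p) (snd p - z)) \<le> \<Phi> w + ereal (cost (fst p) (snd p - w))"
    by (rule inf_attained[OF x, of "snd p"]) blast
  have "ereal (b + cost (fst p) (snd p - z)) \<le> env \<Phi> p"
    using False z(2) by (auto simp: env_def intro: INF_greatest)
  moreover have "env \<Phi> p \<le> ereal (b + cost (fst p) (snd p - z))"
    using env_le[of p z \<Phi>] False z(1) by simp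
  ultimately show thesis using that[of z b] z(1) False by simp
qed

lemma env_finite:
  assumes "fst p > 0"
  shows "env \<Phi> p < \<infinity>"
proof -
  obtain y c where "\<Phi> y = ereal c" by (rule finite_point)
  then show ?thesis using env_le[of p y \<Phi>] assms by auto
qed

section \<open>Convexity of the envelope on its domain and semicontinuity at the boundary\<close>

definition env_dom :: "(real \<times> 'n) set" where
  "env_dom = {p. fst p \<ge> 0 \<and> env \<Phi> p < \<infinity>}"

definition renv :: "real \<times> 'n \<Rightarrow> real" where
  "renv p = real_of_ereal (env \<Phi> p)"

lemma pos_subset_env_dom: "{p. fst p > 0} \<subseteq> env_dom"
  using env_finite by (auto simp: env_dom_def)

lemma env_eq_renv: "p \<in> env_dom \<Longrightarrow> env \<Phi> p = ereal (renv p)"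
  unfolding env_dom_def renv_def by (auto elim!: env_attained)

text \<open>The combination \<open>w\<close> of the minimizers for \<open>p\<close> and
  \<open>q\<close> competes at the combined point; the inequalities for \<open>\<Phi>\<close> and
  for \<open>cost\<close> add up.\<close>

lemma env_combination:
  assumes p: "p \<in> env_dom" and q: "q \<in> env_dom" and t: "0 < t" "t < 1"
  shows "env \<Phi> ((1 - t) *\<^sub>R p + t *\<^sub>R q) \<le> ereal ((1 - t) * renv p + t * renv q)" (is ?le)
    and "ext_strict_convex_on (edom \<Phi>) \<Phi> \<Longrightarrow> fst p > 0 \<Longrightarrow> fst q > 0 \<Longrightarrow> p \<noteq> q \<Longrightarrow>
      env \<Phi> ((1 - t) *\<^sub>R p + t *\<^sub>R q) < ereal ((1 - t) * renv p + t * renv q)" (is "_ \<Longrightarrow> _ \<Longrightarrow> _ \<Longrightarrow> _ \<Longrightarrow> ?less")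
proof -
  have nn: "fst p \<ge> 0" "fst q \<ge> 0" using p q by (auto simp: env_dom_def)
  obtain y b where y: "\<Phi> y = ereal b" "fst p = 0 \<Longrightarrow> y = snd p"
      "env \<Phi> p = ereal (b + cost (fst p) (snd p - y))"
    using p env_attained[of p] unfolding env_dom_def by blast
  obtain z c where z: "\<Phi> z = ereal c" "fst q = 0 \<Longrightarrow> z = snd q"
      "env \<Phi> q = ereal (c + cost (fst q) (snd q - z))"
    using q env_attained[of q] unfolding env_dom_def by blast
  have renv: "renv p = b + cost (fst p) (snd p - y)" "renv q = c + cost (fst q) (snd q - z)"
    using y(3) z(3) by (auto simp: renv_def)
  define s w where "s = (1 - t) *\<^sub>R p + t *\<^sub>R q" and "w = (1 - t) *\<^sub>R y + t *\<^sub>R z"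
  have "fst s = (1 - t) * fst p + t * fst q" by (simp add: s_def)
  moreover have "snd s - w = (1 - t) *\<^sub>R (snd p - y) + t *\<^sub>R (snd q - z)"
    by (simp add: s_def w_def algebra_simps)
  ultimately have cost_s: "cost (fst s) (snd s - w) =
      cost ((1 - t) * fst p + t * fst q) ((1 - t) *\<^sub>R (snd p - y) + t *\<^sub>R (snd q - z))" by simp
  have cost_le: "cost (fst s) (snd s - w) \<le> (1 - t) * cost (fst p) (snd p - y) + t * cost (fst q) (snd q - z)"
    unfolding cost_s by (rule cost_convex) (use nn y(2) z(2) t in auto)
  have \<Phi>_le: "\<Phi> w \<le> ereal ((1 - t) * b + t * c)"
    unfolding w_def by (rule convex_combination_le[OF y(1) z(1)]) (use t in auto)
  then obtain e where e: "\<Phi> w = ereal e" using not_MInf[of w] by (cases "\<Phi> w") auto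
  \<comment> \<open>Both weights are positive, so \<open>fst s = 0\<close> forces \<open>p\<close>
    and \<open>q\<close> onto the boundary, where the minimizers are \<open>snd p\<close> and
    \<open>snd q\<close>.\<close>
  have "w = snd s" if "fst s = 0"
  proof -
    have "(1 - t) * fst p = 0 \<and> t * fst q = 0"
      using that nn t by (simp add: s_def add_nonneg_eq_0_iff)
    then show ?thesis using y(2) z(2) t by (simp add: s_def w_def)
  qed
  then have env_s: "env \<Phi> s \<le> ereal (e + cost (fst s) (snd s - w))"
    using env_le[of s w \<Phi>] e by simp
  have e_le: "e \<le> (1 - t) * b + t * c" using \<Phi>_le e by simp
  have "e + cost (fst s) (snd s - w) \<le> (1 - t) * renv p + t * renv q"
    using e_le cost_le by (simp add: renv algebra_simps)
  then show ?le using env_s by (simp add: s_def[symmetric] order_trans)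
  show ?less if strict: "ext_strict_convex_on (edom \<Phi>) \<Phi>" and pos: "fst p > 0" "fst q > 0" and "p \<noteq> q"
  proof -
    have "e + cost (fst s) (snd s - w) < (1 - t) * renv p + t * renv q"
    \<comment> \<open>Equal minimizers leave different arguments of \<open>cost\<close>, which is
      strict; different minimizers make the inequality for \<open>\<Phi>\<close> strict.\<close>
    proof (cases "y = z")
      case True
      then have "(fst p, snd p - y) \<noteq> (fst q, snd q - z)"
        using \<open>p \<noteq> q\<close> by (auto simp: prod_eq_iff)
      then have "cost (fst s) (snd s - w) < (1 - t) * cost (fst p) (snd p - y) + t * cost (fst q) (snd q - z)"
        unfolding cost_s by (rule cost_strict_convex[OF pos t])
      with e_le show ?thesis by (simp add: renv algebra_simps)
    next
      case False
      moreover have "y \<in> edom \<Phi>" "z \<in> edom \<Phi>" using y(1) z(1) by (auto simp: edom_def)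
      ultimately have "\<Phi> w < ereal (1 - t) * \<Phi> y + ereal t * \<Phi> z"
        using strict t unfolding ext_strict_convex_on_def w_def by blast
      then have "e < (1 - t) * b + t * c" by (simp add: e y(1) z(1))
      with cost_le show ?thesis by (simp add: renv algebra_simps)
    qed
    then show ?less using env_s by (simp add: s_def[symmetric] le_less_trans)
  qed
qed

lemma convex_on_renv: "convex_on env_dom renv"
proof -
  have "(1 - t) *\<^sub>R p + t *\<^sub>R q \<in> env_dom \<and>
      renv ((1 - t) *\<^sub>R p + t *\<^sub>R q) \<le> (1 - t) * renv p + t * renv q"
    if "0 < t" "t < 1" "p \<in> env_dom" "q \<in> env_dom" for t p q
  proof -
    define s where "s = (1 - t) *\<^sub>R p + t *\<^sub>R q"
    have le: "env \<Phi> s \<le> ereal ((1 - t) * renv p + t * renv q)"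
      unfolding s_def by (rule env_combination(1)[OF that(3,4,1,2)])
    have "fst s \<ge> 0" using that unfolding s_def env_dom_def by simp
    with le have "s \<in> env_dom" unfolding env_dom_def by auto
    with le show ?thesis using env_eq_renv[of s] by (simp add: s_def)
  qed
  then show ?thesis
    by (metis (no_types, lifting) convex_onI convex_alt diff_zero scaleR_one scaleR_zero_left
        add.right_neutral add.left_neutral diff_self less_eq_real_def)
qed

text \<open>A finite convex function on an open set of a finite-dimensional space is
  continuous.\<close>

lemma renv_continuous: "continuous_on {p. fst p > 0} renv"
proof -
  have "open {p :: real \<times> 'n. fst p > 0}" by (intro open_Collect_less continuous_intros)
  moreover have "convex_on {p. fst p > 0} renv"
    by (rule convex_on_subset[OF convex_on_renv pos_subset_env_dom])
      (rule convex_pos_fst)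
  ultimately show ?thesis by (rule convex_on_continuous)
qed

text \<open>Competitors near \<open>snd p\<close> have \<open>\<Phi> z > a\<close> by semicontinuity
  and nonnegative cost; for distant ones and small \<open>fst p\<close>, the quadratic term
  outweighs the linear loss.\<close>

lemma env_lsc_boundary:
  assumes "ereal a < \<Phi> y"
  obtains d where "d > 0" and "\<And>p. fst p \<ge> 0 \<Longrightarrow> dist p (0, y) < d \<Longrightarrow> ereal a \<le> env \<Phi> p"
proof -
  obtain \<epsilon> where \<epsilon>: "\<epsilon> > 0" "\<And>z. dist z y < \<epsilon> \<Longrightarrow> ereal a < \<Phi> z"
    using lsc_onD[OF lsc UNIV_I assms] by (metis UNIV_I)
  obtain C where C: "C \<ge> 0"
      "\<And>x y z. x \<ge> 0 \<Longrightarrow> ereal ((norm (y - z))\<^sup>2 / x - C * (1 + norm y + norm (y - z))) \<le> \<Phi> z + ereal (cost x (y - z))"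
    by (rule growth) blast
  define \<delta> where "\<delta> = \<epsilon> / 2"
  define W where "W = \<bar>a\<bar> + C * (1 + norm y + \<delta>)"
  have \<delta>: "\<delta> > 0" using \<epsilon>(1) by (simp add: \<delta>_def)
  have W: "W \<ge> 0" using C(1) \<delta> by (simp add: W_def)
  \<comment> \<open>\<open>fst p < \<delta> / K\<close> gives
    \<open>\<delta> / fst p - C \<ge> W / \<delta>\<close>, so a competitor at distance
    \<open>r \<ge> \<delta>\<close> gains at least \<open>W\<close>, the amount needed to reach
    \<open>a\<close>.\<close>
  define K where "K = C + W / \<delta> + 1"
  have K: "K > 0" using C(1) W \<delta> by (simp add: K_def add_nonneg_pos)
  have "ereal a \<le> env \<Phi> p" if p: "fst p \<ge> 0" "dist p (0, y) < min \<delta> (\<delta> / K)" for p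
  proof -
    have dy: "dist (snd p) y < \<delta>" and dx: "fst p < \<delta> / K"
      using dist_snd_le[of p "(0, y)"] dist_fst_le[of p "(0, y)"] p by (auto simp: dist_real_def)
    have "ereal a \<le> \<Phi> z + ereal (cost (fst p) (snd p - z))" if x: "fst p > 0" for z
    proof (cases "norm (snd p - z) < \<delta>")
      case True
      then have "dist z y < \<epsilon>"
        using dist_triangle[of z y "snd p"] dy by (simp add: dist_norm norm_minus_commute \<delta>_def)
      then have "ereal a \<le> \<Phi> z" using \<epsilon>(2) by (simp add: less_imp_le)
      moreover have "0 \<le> ereal (cost (fst p) (snd p - z))" using p(1) by (simp add: cost_nonneg)
      ultimately show ?thesis by (metis add.right_neutral add_mono)
    next
      case False
      define r where "r = norm (snd p - z)"
      have r: "r \<ge> \<delta>" using False by (simp add: r_def)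
      have "K \<le> \<delta> / fst p" using dx x K by (simp add: field_simps)
      then have k: "W / \<delta> \<le> \<delta> / fst p - C" unfolding K_def by linarith
      have "W \<le> r * (W / \<delta>)" using r \<delta> W by (simp add: field_simps mult_left_mono)
      also have "\<dots> \<le> r * (\<delta> / fst p - C)" using k r \<delta> by (intro mult_left_mono) auto
      also have "\<dots> \<le> r * (r / fst p - C)"
        using r \<delta> x by (intro mult_left_mono diff_right_mono divide_right_mono) auto
      finally have W_le: "W \<le> r\<^sup>2 / fst p - C * r" by (simp add: power2_eq_square algebra_simps)
      have "norm (snd p) \<le> norm y + \<delta>"
        using dy norm_triangle_ineq2[of "snd p" y] by (simp add: dist_norm)
      then have "C * (1 + norm (snd p)) \<le> C * (1 + norm y + \<delta>)" using C(1) by (intro mult_left_mono) auto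
      then have "a \<le> r\<^sup>2 / fst p - C * (1 + norm (snd p) + r)"
        using W_le unfolding W_def by (simp add: algebra_simps)
      then have "ereal a \<le> ereal ((norm (snd p - z))\<^sup>2 / fst p - C * (1 + norm (snd p) + norm (snd p - z)))"
        by (simp add: r_def)
      also have "\<dots> \<le> \<Phi> z + ereal (cost (fst p) (snd p - z))" by (rule C(2)[OF p(1)])
      finally show ?thesis .
    qed
    moreover have "ereal a \<le> \<Phi> (snd p)" using \<epsilon>(2)[of "snd p"] dy \<epsilon>(1) by (simp add: \<delta>_def less_imp_le)
    ultimately show ?thesis using p(1) by (auto simp: env_def intro: INF_greatest)
  qed
  moreover have "min \<delta> (\<delta> / K) > 0" using \<delta> K by simp
  ultimately show thesis using that by blast
qed

section \<open>The smooth extension\<close>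

text \<open>At boundary points with \<open>\<Phi> y = \<infinity>\<close> the real-valued
  \<open>renv\<close> has the default value 0, so the infinite value is restored by hand.\<close>

definition extension :: "real \<times> 'n \<Rightarrow> ereal" where
  "extension p = (if p \<in> env_dom then ereal (mollify renv p) else \<infinity>)"

lemma extension_boundary: "extension (0, y) = \<Phi> y"
  using mollify_boundary[of "(0, y)" renv] env_eq_renv[of "(0, y)"]
  by (auto simp: extension_def env_dom_def)

lemma extension_pos: "fst p > 0 \<Longrightarrow> extension p = ereal (mollify renv p)"
  using pos_subset_env_dom by (auto simp: extension_def)

lemma extension_not_MInf: "extension p \<noteq> -\<infinity>"
  by (simp add: extension_def)

lemma smooth_on_extension: "smooth_on {p. fst p > 0} (\<lambda>p. real_of_ereal (extension p))"
  by (rule smooth_on_cong[OF smooth_on_mollify[OF renv_continuous]]) (simp add: extension_pos)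

lemma convex_on_mollify_renv: "convex_on env_dom (mollify renv)"
  by (rule convex_mollify[OF renv_continuous convex_on_renv pos_subset_env_dom])
    (auto simp: env_dom_def)

lemma extension_convex: "ext_convex_on {p. fst p \<ge> 0} extension"
  unfolding ext_convex_on_def
proof (intro conjI ballI allI impI)
  fix p q :: "real \<times> 'n" and t :: real
  assume "0 \<le> t \<and> t \<le> 1"
  \<comment> \<open>The endpoints are split off because \<open>0 * \<infinity> = 0\<close>; with
    positive weights a point outside \<open>env_dom\<close> makes the right-hand side
    infinite.\<close>
  then consider "t = 0" | "t = 1" | "0 < t" "t < 1" by linarith
  then show "extension ((1 - t) *\<^sub>R p + t *\<^sub>R q) \<le> ereal (1 - t) * extension p + ereal t * extension q"
  proof cases
    case 3
    show ?thesis
    proof (cases "p \<in> env_dom \<and> q \<in> env_dom")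
      case True
      then have "(1 - t) *\<^sub>R p + t *\<^sub>R q \<in> env_dom"
        using convex_on_imp_convex[OF convex_on_renv] 3 by (simp add: convexD_alt)
      with True show ?thesis
        using convex_onD[OF convex_on_mollify_renv, of t p q] 3 by (simp add: extension_def)
    next
      case False
      then have "ereal (1 - t) * extension p + ereal t * extension q = \<infinity>"
        using 3 by (auto simp: extension_def)
      then show ?thesis by (metis ereal_less_eq(1))
    qed
  qed (simp_all add: one_ereal_def[symmetric] zero_ereal_def[symmetric])
qed (rule convex_nonneg_fst)

lemma extension_strict_convex:
  assumes "ext_strict_convex_on (edom \<Phi>) \<Phi>"
  shows "ext_strict_convex_on {p. fst p > 0} extension"
  unfolding ext_strict_convex_on_def
proof (intro conjI ballI allI impI)
  fix p q :: "real \<times> 'n" and t :: real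
  assume "p \<in> {p. fst p > 0}" "q \<in> {p. fst p > 0}" and neq: "p \<noteq> q" and t: "0 < t \<and> t < 1"
  then have pq: "fst p > 0" "fst q > 0" by auto
  define s where "s = (1 - t) *\<^sub>R p + t *\<^sub>R q"
  have s: "fst s > 0" using pq t by (simp add: s_def add_pos_pos)
  have dom: "p \<in> env_dom" "q \<in> env_dom" "s \<in> env_dom" using pq s pos_subset_env_dom by auto
  have "env \<Phi> s < ereal ((1 - t) * renv p + t * renv q)"
    unfolding s_def by (rule env_combination(2)) (use dom t assms pq neq in auto)
  then have less: "renv ((1 - t) *\<^sub>R p + t *\<^sub>R q) < (1 - t) * renv p + t * renv q"
    using env_eq_renv[OF dom(3)] by (simp add: s_def)
  have "convex_on {p. fst p > 0} renv"
    by (rule convex_on_subset[OF convex_on_renv pos_subset_env_dom convex_pos_fst])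
  then have "mollify renv s < (1 - t) * mollify renv p + t * mollify renv q"
    unfolding s_def by (rule mollify_strict_convex) (use pq t less in auto)
  then show "extension ((1 - t) *\<^sub>R p + t *\<^sub>R q) < ereal (1 - t) * extension p + ereal t * extension q"
    using pq s by (simp add: extension_pos s_def)
qed (rule convex_pos_fst)

section \<open>Bounds, limits and continuity of the extension\<close>

lemma extension_nonneg:
  assumes "\<And>y. \<Phi> y \<ge> 0" and "fst p \<ge> 0"
  shows "extension p \<ge> 0"
proof -
  have "env \<Phi> q \<ge> 0" if "fst q \<ge> 0" for q
    using that assms(1) by (auto simp: env_def intro!: INF_greatest add_nonneg_nonneg cost_nonneg)
  then have renv: "renv q \<ge> 0" if "fst q \<ge> 0" for q
    using that by (simp add: renv_def real_of_ereal_pos)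
  have "0 \<le> mollify renv p"
  proof (rule mollify_ge[OF renv_continuous assms(2)])
    fix z :: "real \<times> 'n"
    assume "norm z \<le> 1 / 4"
    then have "z \<in> cube 0 (1 / 2)" by (intro norm_le_imp_mem_cube) simp
    from fst_shift_bounds(1)[OF this assms(2)] show "0 \<le> renv (p + fst p *\<^sub>R z)"
      using assms(2) by (intro renv) linarith
  qed
  then show ?thesis by (simp add: extension_def)
qed

text \<open>For \<open>p\<close> close to \<open>(0, y)\<close> the sample points are close as well,
  so the lower bound for \<open>env\<close> passes to the average.\<close>

lemma extension_lsc_boundary:
  assumes "ereal a < \<Phi> y"
  obtains d where "d > 0" and "\<And>p. fst p \<ge> 0 \<Longrightarrow> dist p (0, y) < d \<Longrightarrow> ereal a \<le> extension p"
proof -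
  obtain d where d: "d > 0" "\<And>p. fst p \<ge> 0 \<Longrightarrow> dist p (0, y) < d \<Longrightarrow> ereal a \<le> env \<Phi> p"
    using env_lsc_boundary[OF assms] by blast
  \<comment> \<open>Half of \<open>d\<close> is reserved for the displacement of the sample
    points.\<close>
  have "ereal a \<le> extension p" if p: "fst p \<ge> 0" "dist p (0, y) < d / 2" for p
  proof (cases "p \<in> env_dom")
    case True
    have "a \<le> mollify renv p"
    proof (rule mollify_ge[OF renv_continuous p(1)])
      fix z :: "real \<times> 'n"
      assume z: "norm z \<le> 1 / 4"
      define q where "q = p + fst p *\<^sub>R z"
      have cube: "z \<in> cube 0 (1 / 2)" using z by (intro norm_le_imp_mem_cube) simp
      have q: "fst q \<ge> 0" using fst_shift_bounds(1)[OF cube p(1)] p(1) unfolding q_def by linarith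
      have "fst p \<le> dist p (0, y)" using dist_fst_le[of p "(0, y)"] by (simp add: dist_real_def)
      then have "fst p * norm z \<le> (d / 2) * 1" using p z d(1) by (intro mult_mono) auto
      then have "dist q p \<le> d / 2" using p(1) by (simp add: q_def dist_norm)
      then have "dist q (0, y) < d" using dist_triangle[of q "(0, y)" p] p(2) by linarith
      then have env: "ereal a \<le> env \<Phi> q" by (rule d(2)[OF q])
      have "q \<in> env_dom"
        using True q p(1) env_finite[of q] fst_shift_bounds(1)[OF cube p(1)]
        by (cases "fst p = 0") (auto simp: q_def env_dom_def)
      then show "a \<le> renv (p + fst p *\<^sub>R z)" using env env_eq_renv by (simp add: q_def)
    qed
    with True show ?thesis by (simp add: extension_def)
  qed (simp add: extension_def)
  then show thesis using that[of "d / 2"] d(1) by simp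
qed

text \<open>At every sample point \<open>q\<close> the competitor \<open>snd p\<close> is used:
  \<open>norm (snd q - snd p) \<le> fst p / 4\<close> and
  \<open>fst p / 2 \<le> fst q \<le> 2 * fst p\<close> bound its cost.\<close>

lemma extension_le:
  assumes "fst p \<ge> 0"
  shows "extension p \<le> \<Phi> (snd p) + ereal (fst p + 4 * (fst p)\<^sup>2)"
proof (cases "fst p = 0 \<or> \<Phi> (snd p) = \<infinity>")
  case True
  then show ?thesis by (cases p) (auto simp: extension_boundary zero_ereal_def[symmetric])
next
  case False
  then have x: "fst p > 0" using assms by simp
  obtain b where b: "\<Phi> (snd p) = ereal b" using False not_MInf[of "snd p"] by (cases "\<Phi> (snd p)") auto
  have "mollify renv p \<le> b + (fst p + 4 * (fst p)\<^sup>2)"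
  proof (rule mollify_le[OF renv_continuous assms])
    fix z :: "real \<times> 'n"
    assume z: "norm z \<le> 1 / 4"
    define q where "q = p + fst p *\<^sub>R z"
    have cube: "z \<in> cube 0 (1 / 2)" using z by (intro norm_le_imp_mem_cube) simp
    have q: "fst p / 2 \<le> fst q" "fst q \<le> 2 * fst p"
      using fst_shift_bounds[OF cube assms] by (simp_all add: q_def)
    then have "fst q > 0" using x by simp
    have "norm (snd z) \<le> 1 / 4" using norm_snd_le[of "snd z" "fst z"] z by simp
    then have "fst p * norm (snd z) \<le> fst p * (1 / 4)" using x by (intro mult_left_mono) auto
    then have "(norm (snd q - snd p))\<^sup>2 \<le> (fst p / 4)\<^sup>2" using x by (intro power_mono) (auto simp: q_def)
    then have "(norm (snd q - snd p))\<^sup>2 / fst q \<le> (fst p / 4)\<^sup>2 / (fst p / 2)"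
      using q x by (intro frac_le) auto
    also have "\<dots> \<le> fst p" using x by (simp add: power2_eq_square field_simps)
    finally have "(norm (snd q - snd p))\<^sup>2 / fst q \<le> fst p" .
    moreover have "(fst q)\<^sup>2 \<le> (2 * fst p)\<^sup>2" using q \<open>fst q > 0\<close> by (intro power_mono) auto
    ultimately have "cost (fst q) (snd q - snd p) \<le> fst p + 4 * (fst p)\<^sup>2"
      by (simp add: cost_def power_mult_distrib)
    moreover have "env \<Phi> q \<le> ereal (b + cost (fst q) (snd q - snd p))"
      using env_le[of q "snd p" \<Phi>] \<open>fst q > 0\<close> b by simp
    moreover have "env \<Phi> q = ereal (renv q)"
      using \<open>fst q > 0\<close> pos_subset_env_dom by (intro env_eq_renv) auto
    ultimately show "renv (p + fst p *\<^sub>R z) \<le> b + (fst p + 4 * (fst p)\<^sup>2)" by (simp add: q_def)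
  qed
  then show ?thesis using x b by (simp add: extension_pos)
qed

text \<open>Squeeze between boundary semicontinuity and \<open>extension_le\<close>. The general
  filter covers both the vertical limit and full continuity at the boundary.\<close>

lemma tendsto_extension_boundary:
  assumes u: "(u \<longlongrightarrow> (0, y)) F" and nn: "eventually (\<lambda>i. fst (u i) \<ge> 0) F"
    and lim: "((\<lambda>i. \<Phi> (snd (u i))) \<longlongrightarrow> \<Phi> y) F"
  shows "((\<lambda>i. extension (u i)) \<longlongrightarrow> \<Phi> y) F"
proof (rule order_tendstoI)
  fix a
  assume "a < \<Phi> y"
  then obtain b where b: "a < ereal b" "ereal b < \<Phi> y" using ereal_dense2 by blast
  obtain d where d: "d > 0" "\<And>p. fst p \<ge> 0 \<Longrightarrow> dist p (0, y) < d \<Longrightarrow> ereal b \<le> extension p"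
    using extension_lsc_boundary[OF b(2)] by blast
  have "eventually (\<lambda>i. dist (u i) (0, y) < d) F" using u d(1) by (rule tendstoD)
  with nn show "eventually (\<lambda>i. a < extension (u i)) F"
    by eventually_elim (use d(2) b(1) less_le_trans in blast)
next
  fix a
  assume a: "\<Phi> y < a"
  \<comment> \<open>An upper bound \<open>a\<close> above \<open>\<Phi> y\<close> excludes the
    infinite value, so extended addition is continuous here.\<close>
  then have fin: "\<bar>\<Phi> y\<bar> \<noteq> \<infinity>" using not_MInf[of y] by (cases "\<Phi> y") auto
  have "((\<lambda>i. fst (u i) + 4 * (fst (u i))\<^sup>2) \<longlongrightarrow> fst (0, y) + 4 * (fst (0, y))\<^sup>2) F"
    by (intro tendsto_intros u)
  then have "((\<lambda>i. ereal (fst (u i) + 4 * (fst (u i))\<^sup>2)) \<longlongrightarrow> ereal 0) F"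
    by (intro tendsto_ereal) simp
  then have "((\<lambda>i. \<Phi> (snd (u i)) + ereal (fst (u i) + 4 * (fst (u i))\<^sup>2)) \<longlongrightarrow> \<Phi> y + ereal 0) F"
    by (intro tendsto_add_ereal lim fin) auto
  then have "eventually (\<lambda>i. \<Phi> (snd (u i)) + ereal (fst (u i) + 4 * (fst (u i))\<^sup>2) < a) F"
    using a by (intro order_tendstoD) (auto simp: zero_ereal_def[symmetric])
  with nn show "eventually (\<lambda>i. extension (u i) < a) F"
    by eventually_elim (use extension_le le_less_trans in blast)
qed

lemma tendsto_extension_pos:
  assumes "fst p > 0"
  shows "(extension \<longlongrightarrow> extension p) (at p)"
proof -
  have op: "open {p :: real \<times> 'n. fst p > 0}" by (intro open_Collect_less continuous_intros)
  have "convex_on {p. fst p > 0} (mollify renv)"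
    by (rule convex_on_subset[OF convex_on_mollify_renv pos_subset_env_dom convex_pos_fst])
  then have "continuous_on {p. fst p > 0} (mollify renv)" by (rule convex_on_continuous[OF op])
  then have "(mollify renv \<longlongrightarrow> mollify renv p) (at p)"
    using assms unfolding continuous_on_eq_continuous_at[OF op] isCont_def by blast
  then have "((\<lambda>q. ereal (mollify renv q)) \<longlongrightarrow> extension p) (at p)"
    by (simp add: extension_pos[OF assms])
  then show ?thesis
    by (rule Lim_transform_within_open[OF _ op]) (use assms in \<open>auto simp: extension_pos\<close>)
qed

lemma lsc_extension: "lsc_on {p. fst p \<ge> 0} extension"
proof (rule lsc_onI)
  fix p :: "real \<times> 'n" and a
  assume p: "p \<in> {p. fst p \<ge> 0}" and a: "ereal a < extension p"
  show "\<exists>d>0. \<forall>q\<in>{p. fst p \<ge> 0}. dist q p < d \<longrightarrow> ereal a \<le> extension q"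
  proof (cases "fst p = 0")
    case True
    then have "p = (0, snd p)" by (simp add: prod_eq_iff)
    with a show ?thesis by (metis extension_boundary extension_lsc_boundary mem_Collect_eq)
  next
    case False
    then have "fst p > 0" using p by simp
    from order_tendstoD(1)[OF tendsto_extension_pos[OF this] a]
    have "eventually (\<lambda>q. ereal a < extension q) (at p)" .
    then obtain d where "d > 0" "\<And>q. q \<noteq> p \<Longrightarrow> dist q p < d \<Longrightarrow> ereal a < extension q"
      unfolding eventually_at by auto
    with a show ?thesis by (metis less_imp_le)
  qed
qed

lemma tendsto_extension_right: "((\<lambda>x. extension (x, y)) \<longlongrightarrow> \<Phi> y) (at_right 0)"
proof (rule tendsto_extension_boundary)
  show "((\<lambda>x. (x, y)) \<longlongrightarrow> (0, y)) (at_right 0)"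
    by (intro tendsto_intros)
  show "eventually (\<lambda>x. fst (x, y) \<ge> 0) (at_right (0::real))"
    by (simp add: eventually_at_filter)
qed simp

text \<open>Continuity of \<open>\<Phi>\<close> is what lets \<open>snd q\<close> vary in the
  boundary limit; in the interior, convexity of the mollified function gives continuity.\<close>

lemma continuous_on_extension:
  assumes "continuous_on UNIV \<Phi>"
  shows "continuous_on {p. fst p \<ge> 0} extension"
  unfolding continuous_on_def
proof
  fix p :: "real \<times> 'n"
  assume p: "p \<in> {p. fst p \<ge> 0}"
  show "(extension \<longlongrightarrow> extension p) (at p within {p. fst p \<ge> 0})"
  proof (cases "fst p = 0")
    case True
    then have p0: "p = (0, snd p)" by (simp add: prod_eq_iff)
    have "(extension \<longlongrightarrow> \<Phi> (snd p)) (at p within {p. fst p \<ge> 0})"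
    proof (rule tendsto_extension_boundary)
      show "((\<lambda>q. q) \<longlongrightarrow> (0, snd p)) (at p within {p. fst p \<ge> 0})"
        using p0 tendsto_ident_at by metis
      show "eventually (\<lambda>q. fst q \<ge> 0) (at p within {p. fst p \<ge> 0})"
        by (simp add: eventually_at_filter)
      have "isCont \<Phi> (snd p)" using assms by (simp add: continuous_on_eq_continuous_at)
      then show "((\<lambda>q. \<Phi> (snd q)) \<longlongrightarrow> \<Phi> (snd p)) (at p within {p. fst p \<ge> 0})"
        by (rule isCont_tendsto_compose) (intro tendsto_intros)
    qed
    moreover have "extension p = \<Phi> (snd p)" using True by (cases p) (simp add: extension_boundary)
    ultimately show ?thesis by simp
  next
    case False
    with p have "fst p > 0" by simp
    then show ?thesis by (intro tendsto_within_subset[OF tendsto_extension_pos]) auto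
  qed
qed

end

theorem theorem1:
  fixes \<Phi> :: "'n::euclidean_space \<Rightarrow> ereal"
  assumes "proper_ext \<Phi>" and "lsc_on UNIV \<Phi>" and "ext_convex_on UNIV \<Phi>"
  defines "Good \<equiv> (\<lambda>\<phi> :: real \<times> 'n \<Rightarrow> ereal.
      (\<forall>p\<in>{p. fst p \<ge> 0}. \<phi> p \<noteq> -\<infinity>) \<and>
      lsc_on {p. fst p \<ge> 0} \<phi> \<and>
      ext_convex_on {p. fst p \<ge> 0} \<phi> \<and>
      (\<forall>y. \<phi> (0, y) = \<Phi> y) \<and>
      (\<forall>y. ((\<lambda>x. \<phi> (x, y)) \<longlongrightarrow> \<Phi> y) (at_right 0)) \<and>
      (\<forall>p\<in>{p. fst p > 0}. \<phi> p \<noteq> \<infinity>) \<and>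
      smooth_on {p. fst p > 0} (\<lambda>p. real_of_ereal (\<phi> p)))"
  shows "(\<exists>\<phi>. Good \<phi>) \<and>
    ((\<forall>y. \<Phi> y \<ge> 0) \<longrightarrow> (\<exists>\<phi>. Good \<phi> \<and> (\<forall>p\<in>{p. fst p \<ge> 0}. \<phi> p \<ge> 0))) \<and>
    (continuous_on UNIV \<Phi> \<longrightarrow> (\<exists>\<phi>. Good \<phi> \<and> continuous_on {p. fst p \<ge> 0} \<phi>)) \<and>
    (ext_strict_convex_on (edom \<Phi>) \<Phi> \<longrightarrow>
       (\<exists>\<phi>. Good \<phi> \<and> ext_strict_convex_on {p. fst p > 0} \<phi>))"
proof -
  interpret closed_convex \<Phi> by unfold_locales (fact assms)+
  \<comment> \<open>The same witness serves all the additional clauses.\<close>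
  have "Good extension"
    unfolding Good_def
    by (intro conjI ballI allI)
      (auto simp: extension_not_MInf extension_boundary extension_pos
        intro: lsc_extension extension_convex tendsto_extension_right smooth_on_extension)
  then show ?thesis
    using extension_nonneg continuous_on_extension extension_strict_convex by blast
qed

end
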